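(* Let $N\ge3$ and let $\Omega\subset\mathbb{R}^N$ be a smooth bounded domain containing the origin. Then there exists a constant $C=C(\Omega)\in(0,\frac14]$ such that $$\int_\Omega\Big(|\nabla u|^2-\frac{(N-2)^2}{4|x|^2}u^2\Big)dx\ \ge\ C(\Omega)\int_\Omega\frac{u^2}{d^2(x)}\,dx\qquad\text{for all }u\in C_0^\infty(\Omega).$$ Moreover, $C(\Omega)$ can be taken to be exactly $\frac14$ for all such domains satisfying the condition $$-\mathrm{div}\big(|x|^{2-N}\nabla d(x)\big)\ge0\quad\text{a.e. in }\Omega.$$
   Context: "Smooth" domain means of class $C^2$. $d(x)=\mathrm{dist}(x,\partial\Omega)$. *)

theory Defs
  imports "HOL-Analysis.Analysis"
begin

(* C^k on the whole space: iterated directional derivatives of order up to k exist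
   (in the Frechet sense) and are continuous. *)
primrec Ck :: "nat \<Rightarrow> ('a::euclidean_space \<Rightarrow> real) \<Rightarrow> bool" where
  "Ck 0 f \<longleftrightarrow> continuous_on UNIV f"
| "Ck (Suc k) f \<longleftrightarrow>
     (\<forall>x. f differentiable (at x)) \<and> (\<forall>v. Ck k (\<lambda>x. frechet_derivative f (at x) v))"

(* Test functions on an open set are represented by their extension by zero. *)
definition test_functions :: "'a::euclidean_space set \<Rightarrow> ('a \<Rightarrow> real) set" where
  "test_functions \<Omega> =
     {u. (\<forall>k. Ck k u) \<and> compact (closure {x. u x \<noteq> 0}) \<and> closure {x. u x \<noteq> 0} \<subseteq> \<Omega>}"

(* Near each boundary point the set is, after a rotation taking e to the last coordinate
   direction, the strict epigraph of a C^2 function \<gamma>; only the values of \<gamma> on the hyperplane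
   orthogonal to e are used. *)
definition C2_boundary :: "'a::euclidean_space set \<Rightarrow> bool" where
  "C2_boundary \<Omega> \<longleftrightarrow>
     (\<forall>p \<in> frontier \<Omega>. \<exists>r>0. \<exists>e \<gamma>. norm e = 1 \<and> Ck 2 \<gamma> \<and>
        \<Omega> \<inter> ball p r = {x \<in> ball p r. x \<bullet> e > \<gamma> (x - (x \<bullet> e) *\<^sub>R e)})"

definition smooth_bounded_domain :: "'a::euclidean_space set \<Rightarrow> bool" where
  "smooth_bounded_domain \<Omega> \<longleftrightarrow>
     open \<Omega> \<and> connected \<Omega> \<and> \<Omega> \<noteq> {} \<and> bounded \<Omega> \<and> C2_boundary \<Omega>"

definition bdist :: "'a::euclidean_space set \<Rightarrow> 'a \<Rightarrow> real" where
  "bdist \<Omega> x = infdist x (frontier \<Omega>)"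

(* Meaningful only where f is differentiable. *)
definition grad :: "('a::euclidean_space \<Rightarrow> real) \<Rightarrow> 'a \<Rightarrow> 'a" where
  "grad f x = (THE D. GDERIV f x :> D)"

(* Meaningful only where F is differentiable. *)
definition divergence :: "('a::euclidean_space \<Rightarrow> 'a) \<Rightarrow> 'a \<Rightarrow> real" where
  "divergence F x = (\<Sum>b\<in>Basis. frechet_derivative F (at x) b \<bullet> b)"

definition weighted_grad_bdist :: "'a::euclidean_space set \<Rightarrow> 'a \<Rightarrow> 'a" where
  "weighted_grad_bdist \<Omega> x = (norm x powr (2 - real DIM('a))) *\<^sub>R grad (bdist \<Omega>) x"

(* - div (|x|^(2-N) grad d) >= 0 a.e. in \<Omega>, pointwise. The first two conjuncts say that the
   divergence exists classically at x: the field is defined near x and differentiable at x.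
   For a bounded C^2 domain they hold a.e. automatically, because d is C^2 off the closure of
   the set where it is not differentiable, which is a null set. *)
definition div_condition :: "'a::euclidean_space set \<Rightarrow> bool" where
  "div_condition \<Omega> \<longleftrightarrow>
     (AE x\<in>\<Omega> in lborel.
        (\<forall>\<^sub>F y in nhds x. bdist \<Omega> differentiable (at y)) \<and>
        weighted_grad_bdist \<Omega> differentiable (at x) \<and>
        - divergence (weighted_grad_bdist \<Omega>) x \<ge> 0)"

end

theory Submission
  imports Defs
begin

text \<open>Write \<open>k = (N - 2) / 2\<close>. The left-hand side equals the integral of \<open>|G|\<^sup>2\<close> for
  \<open>G = \<nabla>u + k u x / |x|\<^sup>2\<close>, and every lower bound comes from expanding \<open>0 \<le> |G - u R|\<^sup>2\<close> for a
  suitable vector field \<open>R\<close>. The choice \<open>R = - x / M\<^sup>2\<close> bounds the \<open>L\<^sup>2\<close> norm of \<open>u\<close>. Near the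
  boundary, where \<open>G\<close> and \<open>\<nabla>u\<close> are comparable up to \<open>u\<close>, the one-dimensional Hardy inequality
  in the direction of the graph controls \<open>u / d\<close>, and compactness gives some positive constant.

  For the constant \<open>1/4\<close> take \<open>R = \<nabla>d / (2 d)\<close>, where \<open>|\<nabla>d| = 1\<close>. This needs the divergence condition
  tested against \<open>u\<^sup>2 / d\<close>, whereas the hypothesis only holds pointwise almost everywhere and ignores
  the singular part of the Laplacian on the ridge. Since \<open>d\<close> is semiconcave, its second
  difference quotients are bounded above by \<open>1 / d\<close>, so a one-sided Fatou argument shows that
  the singular part has the favourable sign.\<close>

subsection \<open>Test functions and integration by parts\<close>

text \<open>For a general field \<open>R\<close>, integrating \<open>0 \<le> |G - u R|^2\<close> by
  parts bounds the deficit from below by the integral of \<open>u^2\<close> times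
  \<open>- |x|^(N-2) div (|x|^(2-N) R) - |R|^2\<close>. This is where the weight of the divergence
  condition comes from: \<open>|x|^(2-N)\<close> is the square of the Hardy ground state
  \<open>|x|^(-k)\<close>. For \<open>R = \<nabla>d / (2 d)\<close> the condition makes the term
  with second derivatives of \<open>d\<close> nonnegative, differentiating \<open>1 / d\<close>
  yields \<open>1 / (2 d^2)\<close>, and \<open>|R|^2\<close> removes \<open>1 / (4 d^2)\<close>;
  the constant \<open>1/4\<close> is what remains.

  The substitution \<open>u = |x|^(-k) v\<close> is never carried out, because \<open>v\<close> need
  not be differentiable at the origin. Instead the identities for \<open>u\<close> are proved with
  the kernel \<open>1 / (|x|^2 + e)\<close> and passed to the limit. The estimates use one
  continuous derivative of \<open>u\<close> only, so cut-offs of class C^1 are enough.\<close>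

lemma integral_translate:
  fixes f :: "'a::euclidean_space \<Rightarrow> real"
  assumes "integrable lborel f"
  shows "integrable lborel (\<lambda>x. f (x + a))" "(LINT x|lborel. f (x + a)) = integral\<^sup>L lborel f"
proof -
  have m: "f \<in> borel_measurable borel" using assms by simp
  have "integrable (distr lborel borel ((+) a)) f"
    using assms by (simp add: lborel_distr_plus)
  then show "integrable lborel (\<lambda>x. f (x + a))"
    by (subst (asm) integrable_distr_eq) (use m in \<open>auto simp: add.commute\<close>)
  have "integral\<^sup>L (distr lborel borel ((+) a)) f = (LINT x|lborel. f (a + x))"
    by (rule integral_distr) (use m in auto)
  then show "(LINT x|lborel. f (x + a)) = integral\<^sup>L lborel f"
    by (simp add: lborel_distr_plus add.commute)
qed

lemma integrable_bounded_support:
  fixes f :: "'a::euclidean_space \<Rightarrow> real"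
  assumes "f \<in> borel_measurable lborel" "bounded K" "\<And>x. x \<notin> K \<Longrightarrow> f x = 0"
    "\<And>x. x \<in> K \<Longrightarrow> \<bar>f x\<bar> \<le> B"
  shows "integrable lborel f"
proof -
  obtain R where R: "K \<subseteq> cball 0 R"
    using \<open>bounded K\<close> by (auto simp: bounded_iff subset_iff)
  show ?thesis
  proof (rule integrableI_bounded_set[where A="cball 0 R" and B="max B 0"])
    show "emeasure lborel (cball (0::'a) R) < \<infinity>"
      by (rule emeasure_bounded_finite) auto
    show "AE x in lborel. x \<in> cball 0 R \<longrightarrow> norm (f x) \<le> max B 0"
    proof (intro AE_I2 impI)
      fix x :: 'a
      show "norm (f x) \<le> max B 0"
        using assms(3,4)[of x] by (cases "x \<in> K") auto
    qed
    show "AE x in lborel. x \<notin> cball 0 R \<longrightarrow> f x = 0"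
      using assms(3) R by (intro AE_I2) blast
  qed (use assms in auto)
qed

lemma integrable_continuous_compact_support:
  fixes F :: "'a::euclidean_space \<Rightarrow> real"
  assumes "compact K" "continuous_on UNIV F" "\<And>x. x \<notin> K \<Longrightarrow> F x = 0"
  shows "integrable lborel F"
proof -
  have "integrable lborel (\<lambda>x. indicator K x *\<^sub>R F x)"
    using assms by (intro borel_integrable_compact) (auto intro: continuous_on_subset)
  moreover have "(\<lambda>x. indicator K x *\<^sub>R F x) = F" using assms(3) by (force simp: indicator_def fun_eq_iff)
  ultimately show ?thesis by simp
qed

section \<open>Difference quotients and their integrals\<close>

text \<open>The steps \<open>1 / Suc n\<close> form a sequence and are never zero, so dominated
  convergence and measurability of limits apply directly. There is no division by
  \<open>norm e\<close>, hence the limit is linear in \<open>e\<close>.\<close>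

definition dquot :: "('a::euclidean_space \<Rightarrow> real) \<Rightarrow> 'a \<Rightarrow> nat \<Rightarrow> 'a \<Rightarrow> real" where
  "dquot f e n x = real (Suc n) * (f (x + (1 / real (Suc n)) *\<^sub>R e) - f x)"

lemma dquot_bound:
  assumes "L-lipschitz_on UNIV f"
  shows "\<bar>dquot f e n x\<bar> \<le> L * norm e"
proof -
  have "\<bar>f (x + (1 / real (Suc n)) *\<^sub>R e) - f x\<bar> \<le> L * norm ((1 / real (Suc n)) *\<^sub>R e)"
    using lipschitz_onD[OF assms, of "x + (1 / real (Suc n)) *\<^sub>R e" x] by (simp add: dist_norm)
  also have "\<dots> = L * norm e / real (Suc n)" by simp
  finally show ?thesis
    unfolding dquot_def abs_mult by (simp add: field_simps)
qed

lemma dquot_supported: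
  assumes "\<And>x. x \<notin> cball 0 R \<Longrightarrow> f x = 0" "x \<notin> cball 0 (R + norm e)"
  shows "dquot f e n x = 0"
proof -
  have "norm ((1 / real (Suc n)) *\<^sub>R e) \<le> norm e" by (simp add: field_simps)
  moreover have "norm x \<le> norm (x + (1 / real (Suc n)) *\<^sub>R e) + norm ((1 / real (Suc n)) *\<^sub>R e)"
    by (metis add_diff_cancel_right' norm_triangle_ineq4)
  ultimately have "norm (x + (1 / real (Suc n)) *\<^sub>R e) > R" "norm x > R"
    using assms(2) by (auto simp del: norm_scaleR intro: le_less_trans[of R "R + norm e"])
  then show ?thesis using assms(1) by (auto simp: dquot_def)
qed

lemma dquot_measurable:
  assumes "continuous_on UNIV f"
  shows "dquot f e n \<in> borel_measurable lborel"
proof -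
  have "continuous_on UNIV (\<lambda>x. f (x + (1 / real (Suc n)) *\<^sub>R e))"
    by (rule continuous_on_compose2[OF assms]) (auto intro!: continuous_intros)
  then have "continuous_on UNIV (dquot f e n)"
    unfolding dquot_def[abs_def] using assms by (intro continuous_intros)
  then show ?thesis by (simp add: borel_measurable_continuous_onI)
qed

lemma dquot_tendsto:
  assumes "GDERIV f x :> D"
  shows "(\<lambda>n. dquot f e n x) \<longlonglongrightarrow> D \<bullet> e"
proof -
  have "((\<lambda>t. x + t *\<^sub>R e) has_derivative (\<lambda>t. t *\<^sub>R e)) (at 0)"
    by (auto intro!: derivative_eq_intros)
  moreover have "(f has_derivative (\<lambda>h. h \<bullet> D)) (at (x + 0 *\<^sub>R e))"
    using assms by (simp add: gderiv_def)
  ultimately have "((\<lambda>t. f (x + t *\<^sub>R e)) has_derivative (\<lambda>t. (t *\<^sub>R e) \<bullet> D)) (at 0)"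
    by (rule has_derivative_compose)
  then have "((\<lambda>t. f (x + t *\<^sub>R e)) has_field_derivative (e \<bullet> D)) (at 0)"
    unfolding has_field_derivative_def by (rule has_derivative_subst) (auto simp: fun_eq_iff)
  then have "((\<lambda>t. (f (x + t *\<^sub>R e) - f x) / t) \<longlongrightarrow> e \<bullet> D) (at 0)"
    unfolding DERIV_def by simp
  moreover have "filterlim (\<lambda>n. 1 / real (Suc n)) (at 0) sequentially"
    unfolding filterlim_at using LIMSEQ_inverse_real_of_nat by (auto simp: inverse_eq_divide)
  ultimately have "(\<lambda>n. (f (x + (1 / real (Suc n)) *\<^sub>R e) - f x) / (1 / real (Suc n))) \<longlonglongrightarrow> e \<bullet> D"
    by (rule filterlim_compose)
  then show ?thesis by (simp add: dquot_def[abs_def] inner_commute mult.commute)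
qed

text \<open>By translation invariance every difference quotient of \<open>f\<close> has integral
  zero. The Lipschitz bound and a common bounded support dominate the quotients, so the zero
  survives in the limit \<open>g\<close>. Every integration by parts for \<open>C1_supported\<close>
  functions rests on this.\<close>

lemma integral_directional_derivative_zero:
  fixes f :: "'a::euclidean_space \<Rightarrow> real"
  assumes lip: "L-lipschitz_on UNIV f"
    and K: "bounded K" "\<And>x. x \<notin> K \<Longrightarrow> f x = 0"
    and g: "g \<in> borel_measurable lborel" "AE x in lborel. (\<lambda>n. dquot f e n x) \<longlonglongrightarrow> g x"
  shows "integrable lborel g" "integral\<^sup>L lborel g = 0"
proof -
  obtain R where "K \<subseteq> cball 0 R"
    using \<open>bounded K\<close> by (auto simp: bounded_iff subset_iff)
  with K have R: "\<And>x. x \<notin> cball 0 R \<Longrightarrow> f x = 0" by blast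
  have cont: "continuous_on UNIV f" by (rule lipschitz_on_continuous_on[OF lip])
  have fi: "integrable lborel f" by (rule integrable_continuous_compact_support[OF compact_cball cont R])
  have 0: "integral\<^sup>L lborel (dquot f e n) = 0" for n
    unfolding dquot_def using integral_translate[OF fi] fi by simp
  \<comment> \<open>All steps are at most \<open>norm e\<close> long, so every quotient vanishes off
    one enlarged ball.\<close>
  let ?w = "\<lambda>x. L * norm e * indicator (cball 0 (R + norm e)) x"
  have w: "integrable lborel ?w"
    by (intro integrable_mult_right integrable_real_indicator emeasure_bounded_finite) auto
  have b: "AE x in lborel. norm (dquot f e n x) \<le> ?w x" for n
    using dquot_bound[OF lip, where e=e and n=n] dquot_supported[OF R, where e=e and n=n]
    by (intro AE_I2) (auto simp: indicator_def)
  show "integrable lborel g"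
    by (rule integrable_dominated_convergence[OF g(1) _ w g(2) b]) (rule dquot_measurable[OF cont])
  have "(\<lambda>n. integral\<^sup>L lborel (dquot f e n)) \<longlonglongrightarrow> integral\<^sup>L lborel g"
    by (rule integral_dominated_convergence[OF g(1) _ w g(2) b]) (rule dquot_measurable[OF cont])
  then show "integral\<^sup>L lborel g = 0"
    unfolding 0 by (simp add: LIMSEQ_const_iff)
qed

section \<open>Compactly supported functions of class C^1\<close>

text \<open>The gradient is an explicit argument, and \<open>K\<close> is any compact set off which
  \<open>f\<close> vanishes rather than the exact support, so that products keep the same
  \<open>K\<close>. Multiplication by a C^1 cut-off or by the reciprocal of a defining function
  stays in this class.\<close>

definition C1_supported :: "'a::euclidean_space set \<Rightarrow> ('a \<Rightarrow> real) \<Rightarrow> ('a \<Rightarrow> 'a) \<Rightarrow> bool" where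
  "C1_supported K f g \<longleftrightarrow> compact K \<and> continuous_on UNIV g \<and> (\<forall>x. GDERIV f x :> g x) \<and> (\<forall>x. x \<notin> K \<longrightarrow> f x = 0)"

lemma GDERIV_unique: "GDERIV f x :> D \<Longrightarrow> GDERIV f x :> E \<Longrightarrow> D = E"
  unfolding gderiv_def
  by (drule (1) has_derivative_unique) (simp add: fun_eq_iff vector_eq_ldot)

lemma grad_eq: "GDERIV f x :> D \<Longrightarrow> grad f x = D"
  unfolding grad_def by (rule the_equality) (auto intro: GDERIV_unique)

lemma GDERIV_zero_outside:
  fixes f :: "'a::euclidean_space \<Rightarrow> real"
  assumes "closed K" "\<And>x. x \<notin> K \<Longrightarrow> f x = 0" "x \<notin> K"
  shows "GDERIV f x :> 0"
proof -
  have "(f has_derivative (\<lambda>h. 0)) (at x)"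
    by (rule has_derivative_transform_within_open[OF has_derivative_const[of 0], where s="- K"])
      (use assms in auto)
  then show ?thesis unfolding gderiv_def by simp
qed

lemma C1_supportedD:
  assumes "C1_supported K f g"
  shows "compact K" "closed K" "continuous_on UNIV g" "GDERIV f x :> g x" "x \<notin> K \<Longrightarrow> f x = 0"
    "continuous_on UNIV f" "x \<notin> K \<Longrightarrow> g x = 0"
proof -
  show 1: "compact K" "closed K" "continuous_on UNIV g" "GDERIV f x :> g x" "x \<notin> K \<Longrightarrow> f x = 0" for x
    using assms by (auto simp: C1_supported_def compact_imp_closed)
  show "continuous_on UNIV f"
    using 1(4) unfolding gderiv_def
    by (meson continuous_at_imp_continuous_on has_derivative_continuous)
  show "x \<notin> K \<Longrightarrow> g x = 0"
    using GDERIV_unique GDERIV_zero_outside[OF 1(2), of f] 1(4,5) by blast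
qed

lemma C1_supported_bounded:
  assumes "C1_supported K f g"
  obtains B where "\<And>x. \<bar>f x\<bar> \<le> B" "\<And>x. norm (g x) \<le> B"
proof -
  note d = C1_supportedD[OF assms]
  obtain B1 where B1: "\<And>x. x \<in> K \<Longrightarrow> norm (f x) \<le> B1"
    using compact_imp_bounded[OF compact_continuous_image[OF continuous_on_subset[OF d(6)] d(1)]]
    unfolding bounded_iff by auto
  obtain B2 where B2: "\<And>x. x \<in> K \<Longrightarrow> norm (g x) \<le> B2"
    using compact_imp_bounded[OF compact_continuous_image[OF continuous_on_subset[OF d(3)] d(1)]]
    unfolding bounded_iff by auto
  show ?thesis
  proof (rule that)
    show "\<bar>f x\<bar> \<le> max 0 (max B1 B2)" for x
      using B1[of x] d(5)[of x] by (cases "x \<in> K") auto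
    show "norm (g x) \<le> max 0 (max B1 B2)" for x
      using B2[of x] d(7)[of x] by (cases "x \<in> K") auto
  qed
qed

lemma GDERIV_lipschitz:
  assumes "convex S" "\<And>x. x \<in> S \<Longrightarrow> GDERIV f x :> g x" "\<And>x. x \<in> S \<Longrightarrow> norm (g x) \<le> B" "0 \<le> B"
  shows "B-lipschitz_on S f"
proof (rule lipschitz_onI)
  fix x y assume "x \<in> S" "y \<in> S"
  have "norm (f x - f y) \<le> B * norm (x - y)"
  proof (rule differentiable_bound[OF assms(1) _ _ \<open>x \<in> S\<close> \<open>y \<in> S\<close>])
    fix z assume z: "z \<in> S"
    show "(f has_derivative (\<lambda>h. h \<bullet> g z)) (at z within S)"
      using assms(2)[OF z] has_derivative_at_withinI unfolding gderiv_def by blast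
    show "onorm (\<lambda>h. h \<bullet> g z) \<le> B"
      by (rule onorm_bound[OF assms(4)])
        (metis Cauchy_Schwarz_ineq2 assms(3)[OF z] mult.commute mult_right_mono norm_ge_zero order_trans real_norm_def)
  qed
  then show "dist (f x) (f y) \<le> B * dist x y" by (simp add: dist_norm)
qed (rule assms)

lemma C1_supported_lipschitz:
  assumes "C1_supported K f g"
  obtains L where "L-lipschitz_on UNIV f"
proof -
  obtain B where B: "\<And>x. norm (g x) \<le> B" using C1_supported_bounded[OF assms] by metis
  have "B-lipschitz_on UNIV f"
    using C1_supportedD(4)[OF assms] B order_trans[OF norm_ge_zero B]
    by (intro GDERIV_lipschitz) auto
  then show ?thesis by (rule that)
qed

lemma C1_supported_integral_zero:
  assumes "C1_supported K f g"
  shows "integrable lborel (\<lambda>x. g x \<bullet> e)" "(LINT x|lborel. g x \<bullet> e) = 0"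
proof -
  obtain L where L: "L-lipschitz_on UNIV f" by (rule C1_supported_lipschitz[OF assms])
  note d = C1_supportedD[OF assms]
  have m: "(\<lambda>x. g x \<bullet> e) \<in> borel_measurable lborel"
    using d(3) by (simp add: borel_measurable_continuous_onI continuous_intros)
  note * = integral_directional_derivative_zero[OF L compact_imp_bounded[OF d(1)] d(5) m, of e]
  show "integrable lborel (\<lambda>x. g x \<bullet> e)" "(LINT x|lborel. g x \<bullet> e) = 0"
    using * dquot_tendsto[OF d(4)] by auto
qed

text \<open>The second factor may be singular away from \<open>K\<close>, as a reciprocal is: off
  \<open>K\<close> both \<open>f\<close> and \<open>g\<close> vanish, so the product and the claimed
  gradient are zero there whatever \<open>q\<close> does. Continuity is then glued from the two open
  sets \<open>U\<close> and \<open>-K\<close>, which cover the space.\<close>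

lemma C1_supported_mult:
  assumes f: "C1_supported K f g"
    and U: "open U" "K \<subseteq> U" "continuous_on U gq" "\<And>x. x \<in> U \<Longrightarrow> GDERIV q x :> gq x"
  shows "C1_supported K (\<lambda>x. f x * q x) (\<lambda>x. f x *\<^sub>R gq x + q x *\<^sub>R g x)"
  unfolding C1_supported_def
proof (intro conjI allI impI)
  note d = C1_supportedD[OF f]
  show "compact K" by fact
  show "f x * q x = 0" if "x \<notin> K" for x using d(5) that by simp
  have z: "f x *\<^sub>R gq x + q x *\<^sub>R g x = 0" if "x \<notin> K" for x
    using d(5,7) that by simp
  show "GDERIV (\<lambda>x. f x * q x) x :> f x *\<^sub>R gq x + q x *\<^sub>R g x" for x
  proof (cases "x \<in> K")
    case True
    then show ?thesis using U d by (intro GDERIV_mult) auto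
  next
    case False
    then show ?thesis
      unfolding z[OF False] by (intro GDERIV_zero_outside[OF d(2)]) (use d(5) in auto)
  qed
  have "continuous_on U q"
    using U(4) unfolding gderiv_def
    by (meson continuous_at_imp_continuous_on has_derivative_continuous)
  then have "continuous_on U (\<lambda>x. f x *\<^sub>R gq x + q x *\<^sub>R g x)"
    using d(3,6) U(3) by (intro continuous_intros) (auto intro: continuous_on_subset)
  moreover have "continuous_on (-K) (\<lambda>x. f x *\<^sub>R gq x + q x *\<^sub>R g x)"
    using z by (subst continuous_on_cong[OF refl, of _ _ "\<lambda>_. 0"]) auto
  ultimately have "continuous_on (U \<union> -K) (\<lambda>x. f x *\<^sub>R gq x + q x *\<^sub>R g x)"
    using U(1) d(2) by (intro continuous_on_open_Un) auto
  moreover have "U \<union> -K = UNIV" using U(2) by auto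
  ultimately show "continuous_on UNIV (\<lambda>x. f x *\<^sub>R gq x + q x *\<^sub>R g x)" by simp
qed

lemma GDERIV_inner_left: "GDERIV (\<lambda>x. x \<bullet> b) x :> b"
  unfolding gderiv_def by (auto intro!: derivative_eq_intros)

lemma differentiable_imp_GDERIV:
  fixes f :: "'a::euclidean_space \<Rightarrow> real"
  assumes "f differentiable (at x)"
  shows "GDERIV f x :> grad f x" "grad f x = (\<Sum>b\<in>Basis. frechet_derivative f (at x) b *\<^sub>R b)"
proof -
  let ?G = "\<Sum>b\<in>Basis. frechet_derivative f (at x) b *\<^sub>R b"
  have h: "(f has_derivative frechet_derivative f (at x)) (at x)"
    using assms frechet_derivative_works by blast
  have "frechet_derivative f (at x) = (\<lambda>h. h \<bullet> ?G)"
  proof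
    fix h
    have "frechet_derivative f (at x) h = frechet_derivative f (at x) (\<Sum>b\<in>Basis. (h \<bullet> b) *\<^sub>R b)"
      by (simp add: euclidean_representation)
    also have "\<dots> = (\<Sum>b\<in>Basis. (h \<bullet> b) * frechet_derivative f (at x) b)"
      using has_derivative_linear[OF h] by (simp add: linear_sum linear_scale)
    also have "\<dots> = h \<bullet> ?G" by (simp add: inner_sum_right mult.commute)
    finally show "frechet_derivative f (at x) h = h \<bullet> ?G" .
  qed
  then have G: "GDERIV f x :> ?G" using h by (simp add: gderiv_def)
  show eq: "grad f x = ?G" by (rule grad_eq[OF G])
  show "GDERIV f x :> grad f x" unfolding eq by (rule G)
qed

text \<open>The directional derivatives are continuous by definition when \<open>k = 0\<close>, and
  because they are themselves differentiable otherwise.\<close>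

lemma Ck_C1:
  fixes f :: "'a::euclidean_space \<Rightarrow> real"
  assumes "Ck (Suc k) f"
  shows "GDERIV f x :> grad f x" "continuous_on UNIV (grad f)"
proof -
  have df: "f differentiable (at x)" and dk: "Ck k (\<lambda>x. frechet_derivative f (at x) v)" for x v
    using assms unfolding Ck.simps by blast+
  have c: "continuous_on UNIV (\<lambda>x. frechet_derivative f (at x) v)" for v
  proof (cases k)
    case 0
    then show ?thesis using dk[of v] by simp
  next
    case (Suc k')
    have "(\<lambda>x. frechet_derivative f (at x) v) differentiable (at x)" for x
      using dk[of v] unfolding Suc Ck.simps by blast
    then show ?thesis
      by (intro continuous_at_imp_continuous_on ballI differentiable_imp_continuous_within)
  qed
  show "GDERIV f x :> grad f x" by (rule differentiable_imp_GDERIV[OF df])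
  have eq: "grad f = (\<lambda>x. \<Sum>b\<in>Basis. frechet_derivative f (at x) b *\<^sub>R b)"
    by (rule ext) (rule differentiable_imp_GDERIV[OF df])
  show "continuous_on UNIV (grad f)"
    unfolding eq by (intro continuous_on_sum continuous_on_scaleR continuous_on_const c)
qed

lemma test_functions_C1_supported:
  assumes "u \<in> test_functions \<Omega>"
  obtains K where "C1_supported K u (grad u)" "K \<subseteq> \<Omega>"
proof -
  have "Ck (Suc 0) u" using assms unfolding test_functions_def by blast
  note * = Ck_C1[OF this]
  have sub: "closure {x. u x \<noteq> 0} \<subseteq> \<Omega>" and c: "compact (closure {x. u x \<noteq> 0})"
    using assms unfolding test_functions_def by blast+
  have z: "u x = 0" if "x \<notin> closure {x. u x \<noteq> 0}" for x
    using that closure_subset[of "{x. u x \<noteq> 0}"] by blast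
  have "C1_supported (closure {x. u x \<noteq> 0}) u (grad u)"
    unfolding C1_supported_def using * c z by blast
  then show ?thesis using sub by (rule that)
qed

text \<open>This is the divergence theorem for the field \<open>f x * x\<close>: for each basis
  vector \<open>b\<close> the derivative of \<open>f x * (x \<bullet> b)\<close> along
  \<open>b\<close> has integral zero, and the sum of these derivatives is
  \<open>DIM('a) * f x + x \<bullet> g x\<close>.\<close>

lemma integral_Euler:
  fixes f :: "'a::euclidean_space \<Rightarrow> real"
  assumes "C1_supported K f g"
  shows "(LINT x|lborel. x \<bullet> g x) = - real DIM('a) * integral\<^sup>L lborel f"
proof -
  note d = C1_supportedD[OF assms]
  have *: "C1_supported K (\<lambda>x. f x * (x \<bullet> b)) (\<lambda>x. f x *\<^sub>R b + (x \<bullet> b) *\<^sub>R g x)" for b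
    by (rule C1_supported_mult[OF assms, of UNIV "\<lambda>_. b"]) (auto intro: GDERIV_inner_left)
  have fi: "integrable lborel f" using d by (intro integrable_continuous_compact_support[of K]) auto
  have gi: "integrable lborel (\<lambda>x. x \<bullet> g x)"
    using d by (intro integrable_continuous_compact_support[of K]) (auto intro!: continuous_intros)
  have "0 = (\<Sum>b\<in>Basis. integral\<^sup>L lborel (\<lambda>x. (f x *\<^sub>R b + (x \<bullet> b) *\<^sub>R g x) \<bullet> b))"
    using C1_supported_integral_zero(2)[OF *] by simp
  also have "\<dots> = (LINT x|lborel. (\<Sum>b\<in>Basis. (f x *\<^sub>R b + (x \<bullet> b) *\<^sub>R g x) \<bullet> b))"
    by (rule Bochner_Integration.integral_sum[symmetric]) (rule C1_supported_integral_zero[OF *])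
  also have "\<dots> = (LINT x|lborel. real DIM('a) * f x + x \<bullet> g x)"
  proof (rule Bochner_Integration.integral_cong[OF refl])
    fix x
    have "(\<Sum>b\<in>Basis. (f x *\<^sub>R b + (x \<bullet> b) *\<^sub>R g x) \<bullet> b) = (\<Sum>b\<in>(Basis::'a set). f x) + (\<Sum>b\<in>Basis. (x \<bullet> b) * (g x \<bullet> b))"
      unfolding sum.distrib[symmetric] by (rule sum.cong) (auto simp: inner_simps)
    then show "(\<Sum>b\<in>Basis. (f x *\<^sub>R b + (x \<bullet> b) *\<^sub>R g x) \<bullet> b) = real DIM('a) * f x + x \<bullet> g x"
      by (simp add: euclidean_inner[of x "g x"])
  qed
  also have "\<dots> = real DIM('a) * integral\<^sup>L lborel f + (LINT x|lborel. x \<bullet> g x)"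
    using fi gi by simp
  finally show ?thesis by simp
qed

subsection \<open>The Hardy inequality with a point singularity\<close>

lemma C1_supported_square:
  assumes "C1_supported K u g"
  shows "C1_supported K (\<lambda>x. (u x)\<^sup>2) (\<lambda>x. (2 * u x) *\<^sub>R g x)"
proof -
  have "C1_supported K (\<lambda>x. u x * u x) (\<lambda>x. u x *\<^sub>R g x + u x *\<^sub>R g x)"
    using C1_supportedD[OF assms] by (intro C1_supported_mult[OF assms, of UNIV]) auto
  then show ?thesis by (simp add: power2_eq_square scaleR_add_left[symmetric])
qed

lemma C1_supported_norm_grad_integrable:
  assumes "C1_supported K u g"
  shows "integrable lborel (\<lambda>x. (norm (g x))\<^sup>2)" "integrable lborel (\<lambda>x. (u x)\<^sup>2)"
  using C1_supportedD[OF assms]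
  by (auto intro!: integrable_continuous_compact_support[of K] continuous_intros)

lemma AE_lborel_nonzero: "AE x in lborel. (x::'a::euclidean_space) \<noteq> 0"
  by (rule AE_lborel_singleton)

text \<open>\<open>integral_Euler\<close> is applied to \<open>u^2 q\<close>. With
  \<open>e > 0\<close> the kernel \<open>q\<close> is smooth at the origin as well, and its radial
  derivative \<open>x \<bullet> \<nabla>q\<close> equals \<open>- 2 |x|^2 q^2\<close>.\<close>

lemma integral_Euler_regularised:
  fixes u :: "'a::euclidean_space \<Rightarrow> real"
  assumes u: "C1_supported K u g" and e: "e > 0"
  defines "q \<equiv> \<lambda>x. inverse ((norm x)\<^sup>2 + e)"
  shows "(LINT x|lborel. 2 * u x * (x \<bullet> g x) * q x)
    = - (LINT x|lborel. real DIM('a) * ((u x)\<^sup>2 * q x) - 2 * (u x)\<^sup>2 * (norm x)\<^sup>2 * (q x)\<^sup>2)"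
    "integrable lborel (\<lambda>x. 2 * u x * (x \<bullet> g x) * q x)"
    "integrable lborel (\<lambda>x. (u x)\<^sup>2 * q x)"
    "integrable lborel (\<lambda>x. 2 * (u x)\<^sup>2 * (norm x)\<^sup>2 * (q x)\<^sup>2)"
proof -
  note d = C1_supportedD[OF u]
  have pos: "(norm x)\<^sup>2 + e \<noteq> 0" for x :: 'a using e
    by (metis add_pos_nonneg add.commute less_irrefl zero_le_power2)
  have qc: "continuous_on UNIV q"
    unfolding q_def using pos by (intro continuous_intros) auto
  have "GDERIV (\<lambda>x. x \<bullet> x) x :> 2 *\<^sub>R x" for x :: 'a
    unfolding gderiv_def by (auto intro!: derivative_eq_intros simp: inner_commute)
  then have "GDERIV (\<lambda>x. (norm x)\<^sup>2 + e) x :> 2 *\<^sub>R x + 0" for x :: 'a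
    by (intro GDERIV_add GDERIV_const) (simp add: power2_norm_eq_inner)
  then have G: "GDERIV q x :> - (q x)\<^sup>2 *\<^sub>R (2 *\<^sub>R x)" for x
    unfolding q_def by (intro GDERIV_inverse pos) simp
  have S: "C1_supported K (\<lambda>x. (u x)\<^sup>2 * q x)
      (\<lambda>x. (u x)\<^sup>2 *\<^sub>R (- (q x)\<^sup>2 *\<^sub>R (2 *\<^sub>R x)) + q x *\<^sub>R ((2 * u x) *\<^sub>R g x))"
    by (rule C1_supported_mult[OF C1_supported_square[OF u] open_UNIV subset_UNIV _ G])
      (intro continuous_intros qc)
  show i1: "integrable lborel (\<lambda>x. 2 * u x * (x \<bullet> g x) * q x)"
    and i2: "integrable lborel (\<lambda>x. (u x)\<^sup>2 * q x)"
    and i3: "integrable lborel (\<lambda>x. 2 * (u x)\<^sup>2 * (norm x)\<^sup>2 * (q x)\<^sup>2)"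
    using d qc by (auto intro!: integrable_continuous_compact_support[of K] continuous_intros)
  have "x \<bullet> ((u x)\<^sup>2 *\<^sub>R (- (q x)\<^sup>2 *\<^sub>R (2 *\<^sub>R x)) + q x *\<^sub>R ((2 * u x) *\<^sub>R g x)) =
     2 * u x * (x \<bullet> g x) * q x - 2 * (u x)\<^sup>2 * (norm x)\<^sup>2 * (q x)\<^sup>2" for x
    by (simp add: inner_simps power2_norm_eq_inner algebra_simps)
  then have "(LINT x|lborel. 2 * u x * (x \<bullet> g x) * q x - 2 * (u x)\<^sup>2 * (norm x)\<^sup>2 * (q x)\<^sup>2)
     = - real DIM('a) * (LINT x|lborel. (u x)\<^sup>2 * q x)"
    using integral_Euler[OF S] by simp
  then show "(LINT x|lborel. 2 * u x * (x \<bullet> g x) * q x)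
    = - (LINT x|lborel. real DIM('a) * ((u x)\<^sup>2 * q x) - 2 * (u x)\<^sup>2 * (norm x)\<^sup>2 * (q x)\<^sup>2)"
    using i1 i2 i3 by simp
qed

text \<open>The square \<open>|g + k u q x|^2\<close> is integrated with
  \<open>k = (N - 2) / 2\<close>, the value for which \<open>k (N - 2) - k^2\<close> is
  largest.\<close>

lemma hardy_regularised:
  fixes u :: "'a::euclidean_space \<Rightarrow> real"
  assumes u: "C1_supported K u g" and e: "e > 0" and N: "DIM('a) \<ge> 3"
  defines "q \<equiv> \<lambda>x. inverse ((norm x)\<^sup>2 + e)"
  shows "((real DIM('a) - 2) / 2)\<^sup>2 * (LINT x|lborel. (u x)\<^sup>2 * q x) \<le> (LINT x|lborel. (norm (g x))\<^sup>2)"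
proof -
  define k where "k = (real DIM('a) - 2) / 2"
  have k: "k > 0" using N by (simp add: k_def)
  have fq: "inverse ((norm x)\<^sup>2 + e) = q x" for x by (simp add: q_def)
  note E = integral_Euler_regularised[OF u e, unfolded fq]
  note i = C1_supported_norm_grad_integrable[OF u]
  have ir: "integrable lborel (\<lambda>x. real DIM('a) * ((u x)\<^sup>2 * q x) - 2 * (u x)\<^sup>2 * (norm x)\<^sup>2 * (q x)\<^sup>2)"
    by (intro Bochner_Integration.integrable_diff integrable_mult_right E)
  \<comment> \<open>By \<open>E(1)\<close> the second term and the positive part of the last group
    have opposite integrals, so only \<open>- k^2 u^2 q\<close> is left beside the Dirichlet
    term.\<close>
  have "0 \<le> (LINT x|lborel. (norm (g x))\<^sup>2 + k * (2 * u x * (x \<bullet> g x) * q x)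
      + (k * (real DIM('a) * ((u x)\<^sup>2 * q x) - 2 * (u x)\<^sup>2 * (norm x)\<^sup>2 * (q x)\<^sup>2) - k\<^sup>2 * ((u x)\<^sup>2 * q x)))"
  proof (rule Bochner_Integration.integral_nonneg)
    fix x
    have q: "q x > 0" "(norm x)\<^sup>2 * q x \<le> 1" using e
      unfolding q_def by (auto simp: field_simps add_pos_nonneg add_nonneg_pos)
    have "0 \<le> (norm (g x + (k * u x * q x) *\<^sub>R x))\<^sup>2" by simp
    also have "\<dots> = (norm (g x))\<^sup>2 + k * (2 * u x * (x \<bullet> g x) * q x) + k\<^sup>2 * (u x)\<^sup>2 * ((norm x)\<^sup>2 * q x) * q x"
      unfolding power2_norm_eq_inner by (simp add: inner_simps inner_commute power2_eq_square algebra_simps)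
    \<comment> \<open>The error of the regularisation is
      \<open>k (k + 2) u^2 q (1 - |x|^2 q)\<close>; it has the right sign because
      \<open>|x|^2 q \<le> 1\<close>.\<close>
    also have "k\<^sup>2 * (u x)\<^sup>2 * ((norm x)\<^sup>2 * q x) * q x \<le> k * (real DIM('a) * ((u x)\<^sup>2 * q x) - 2 * (u x)\<^sup>2 * (norm x)\<^sup>2 * (q x)\<^sup>2) - k\<^sup>2 * ((u x)\<^sup>2 * q x)"
    proof -
      have "k * (real DIM('a) * ((u x)\<^sup>2 * q x) - 2 * (u x)\<^sup>2 * (norm x)\<^sup>2 * (q x)\<^sup>2) - k\<^sup>2 * ((u x)\<^sup>2 * q x)
         - k\<^sup>2 * (u x)\<^sup>2 * ((norm x)\<^sup>2 * q x) * q x = k * (k + 2) * ((u x)\<^sup>2 * q x * (1 - (norm x)\<^sup>2 * q x))"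
        unfolding k_def by (simp add: power2_eq_square field_simps)
      also have "\<dots> \<ge> 0" using k q by (intro mult_nonneg_nonneg) auto
      finally show ?thesis by simp
    qed
    finally show "0 \<le> (norm (g x))\<^sup>2 + k * (2 * u x * (x \<bullet> g x) * q x)
      + (k * (real DIM('a) * ((u x)\<^sup>2 * q x) - 2 * (u x)\<^sup>2 * (norm x)\<^sup>2 * (q x)\<^sup>2) - k\<^sup>2 * ((u x)\<^sup>2 * q x))"
      by simp
  qed
  also have "\<dots> = (LINT x|lborel. (norm (g x))\<^sup>2) - k\<^sup>2 * (LINT x|lborel. (u x)\<^sup>2 * q x)"
    by (simp only: E(1) i(1) E(2,3) ir Bochner_Integration.integral_add Bochner_Integration.integral_diff
        Bochner_Integration.integrable_add Bochner_Integration.integrable_diff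
        integral_mult_right_zero integrable_mult_right)
  finally show ?thesis by (simp add: k_def)
qed

lemma inverse_regularised_tendsto:
  fixes x :: "'a::real_normed_vector"
  assumes "x \<noteq> 0"
  shows "(\<lambda>n. inverse ((norm x)\<^sup>2 + 1 / real (Suc n))) \<longlonglongrightarrow> 1 / (norm x)\<^sup>2"
proof -
  have "(\<lambda>n. inverse ((norm x)\<^sup>2 + inverse (real (Suc n)))) \<longlonglongrightarrow> inverse ((norm x)\<^sup>2 + 0)"
    by (intro tendsto_intros LIMSEQ_inverse_real_of_nat) (use assms in auto)
  then show ?thesis by (simp add: inverse_eq_divide)
qed

text \<open>The regularised inequality bounds the integrals of \<open>u^2 q\<close> independently of
  the regularisation, and \<open>q\<close> increases to \<open>1 / |x|^2\<close>, so monotone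
  convergence applies.\<close>

lemma hardy_integrable:
  fixes u :: "'a::euclidean_space \<Rightarrow> real"
  assumes u: "C1_supported K u g" and N: "DIM('a) \<ge> 3"
  shows "integrable lborel (\<lambda>x. (u x)\<^sup>2 / (norm x)\<^sup>2)"
proof -
  define k where "k = (real DIM('a) - 2) / 2"
  have k: "k > 0" using N by (simp add: k_def)
  let ?q = "\<lambda>n x. inverse ((norm x)\<^sup>2 + 1 / real (Suc n))"
  let ?f = "\<lambda>n x. (u x)\<^sup>2 * ?q n x"
  have i: "integrable lborel (?f n)" for n
    by (rule integral_Euler_regularised(3)[OF u]) simp
  have mono: "?f m x \<le> ?f n x" if "m \<le> n" for m n x
  proof -
    have p: "0 < 1 / real (Suc n)" "1 / real (Suc n) \<le> 1 / real (Suc m)"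
      using that by (auto simp: frac_le)
    then have "0 < (norm x)\<^sup>2 + 1 / real (Suc n)" by (intro add_nonneg_pos) auto
    then have "?q m x \<le> ?q n x" using p by (intro le_imp_inverse_le) auto
    then show ?thesis by (rule mult_left_mono) simp
  qed
  have bd: "integral\<^sup>L lborel (?f n) \<le> (LINT x|lborel. (norm (g x))\<^sup>2) / k\<^sup>2" for n
    using hardy_regularised[OF u _ N, of "1 / real (Suc n)"] k
    by (simp add: k_def field_simps)
  have "incseq (\<lambda>n. integral\<^sup>L lborel (?f n))"
    by (intro incseq_SucI integral_mono i mono) simp
  then obtain L where L: "(\<lambda>n. integral\<^sup>L lborel (?f n)) \<longlonglongrightarrow> L"
    using incseq_convergent[of "\<lambda>n. integral\<^sup>L lborel (?f n)"] bd by blast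
  show ?thesis
  proof (rule integrable_monotone_convergence[OF i _ _ L])
    show "AE x in lborel. mono (\<lambda>n. ?f n x)" using mono by (intro AE_I2) (auto simp: mono_def)
    show "AE x in lborel. (\<lambda>n. ?f n x) \<longlonglongrightarrow> (u x)\<^sup>2 / (norm x)\<^sup>2"
      using AE_lborel_nonzero
    proof eventually_elim
      case (elim x)
      have "(\<lambda>n. ?f n x) \<longlonglongrightarrow> (u x)\<^sup>2 * (1 / (norm x)\<^sup>2)"
        by (intro tendsto_intros inverse_regularised_tendsto elim)
      then show ?case by simp
    qed
    show "(\<lambda>x. (u x)\<^sup>2 / (norm x)\<^sup>2) \<in> borel_measurable lborel"
      using C1_supportedD(6)[OF u]
      by (intro borel_measurable_divide borel_measurable_power) (auto simp: borel_measurable_continuous_onI)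
  qed
qed

text \<open>The regularised Euler identity is passed to the limit. Its two sides are dominated by
  \<open>u^2 / |x|^2 + |g|^2\<close> and by a multiple of \<open>u^2 / |x|^2\<close>, which are
  integrable by \<open>hardy_integrable\<close>. In the limit \<open>|x|^2 q\<close> becomes 1,
  which turns the factor \<open>N\<close> into \<open>N - 2\<close>.\<close>

lemma integral_radial_derivative:
  fixes u :: "'a::euclidean_space \<Rightarrow> real"
  assumes u: "C1_supported K u g" and N: "DIM('a) \<ge> 3"
  shows "integrable lborel (\<lambda>x. 2 * u x * (x \<bullet> g x) / (norm x)\<^sup>2)"
    "(LINT x|lborel. 2 * u x * (x \<bullet> g x) / (norm x)\<^sup>2) = - (real DIM('a) - 2) * (LINT x|lborel. (u x)\<^sup>2 / (norm x)\<^sup>2)"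
proof -
  note d = C1_supportedD[OF u]
  note ih = hardy_integrable[OF u N]
  let ?q = "\<lambda>n x. inverse ((norm x)\<^sup>2 + 1 / real (Suc n))"
  let ?l = "\<lambda>n x. 2 * u x * (x \<bullet> g x) * ?q n x"
  let ?r = "\<lambda>n x. real DIM('a) * ((u x)\<^sup>2 * ?q n x) - 2 * (u x)\<^sup>2 * (norm x)\<^sup>2 * (?q n x)\<^sup>2"
  let ?L = "\<lambda>x. 2 * u x * (x \<bullet> g x) / (norm x)\<^sup>2"
  let ?R = "\<lambda>x. (real DIM('a) - 2) * ((u x)\<^sup>2 / (norm x)\<^sup>2)"
  let ?w = "\<lambda>x. (u x)\<^sup>2 / (norm x)\<^sup>2 + (norm (g x))\<^sup>2"
  let ?v = "\<lambda>x. (real DIM('a) + 2) * ((u x)\<^sup>2 / (norm x)\<^sup>2)"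
  have m: "u \<in> borel_measurable lborel" "g \<in> borel_measurable lborel"
    using d by (auto simp: borel_measurable_continuous_onI)
  have w: "integrable lborel ?w" using ih C1_supported_norm_grad_integrable[OF u] by simp
  have v: "integrable lborel ?v" by (rule integrable_mult_right[OF ih])
  have q: "?q n x > 0" "?q n x \<le> 1 / (norm x)\<^sup>2" if "x \<noteq> 0" for n and x :: 'a
    using that by (auto simp: inverse_eq_divide intro!: frac_le add_pos_pos)
  have mL: "?L \<in> borel_measurable lborel" using m by simp
  have mR: "?R \<in> borel_measurable lborel" using m by simp
  have ml: "?l n \<in> borel_measurable lborel" for n using m by simp
  have mr: "?r n \<in> borel_measurable lborel" for n using m by simp
  have limL: "AE x in lborel. (\<lambda>n. ?l n x) \<longlonglongrightarrow> ?L x"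
    using AE_lborel_nonzero
  proof eventually_elim
    case (elim x)
    have "(\<lambda>n. ?l n x) \<longlonglongrightarrow> 2 * u x * (x \<bullet> g x) * (1 / (norm x)\<^sup>2)"
      by (intro tendsto_intros inverse_regularised_tendsto elim)
    then show ?case by simp
  qed
  have limR: "AE x in lborel. (\<lambda>n. ?r n x) \<longlonglongrightarrow> ?R x"
    using AE_lborel_nonzero
  proof eventually_elim
    case (elim x)
    have "(\<lambda>n. ?r n x) \<longlonglongrightarrow> real DIM('a) * ((u x)\<^sup>2 * (1 / (norm x)\<^sup>2)) - 2 * (u x)\<^sup>2 * (norm x)\<^sup>2 * (1 / (norm x)\<^sup>2)\<^sup>2"
      by (intro tendsto_intros inverse_regularised_tendsto elim)
    also have "real DIM('a) * ((u x)\<^sup>2 * (1 / (norm x)\<^sup>2)) - 2 * (u x)\<^sup>2 * (norm x)\<^sup>2 * (1 / (norm x)\<^sup>2)\<^sup>2 = ?R x"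
      using elim by (simp add: field_simps power2_eq_square)
    finally show ?case .
  qed
  have bL: "AE x in lborel. norm (?l n x) \<le> ?w x" for n
    using AE_lborel_nonzero
  proof eventually_elim
    case (elim x)
    have "norm (?l n x) = 2 * \<bar>u x\<bar> * \<bar>x \<bullet> g x\<bar> * ?q n x"
      using q[OF elim, of n] by (simp add: abs_mult)
    also have "\<dots> \<le> 2 * \<bar>u x\<bar> * (norm x * norm (g x)) * (1 / (norm x)\<^sup>2)"
      using q[OF elim, of n] Cauchy_Schwarz_ineq2[of x "g x"] by (intro mult_mono mult_nonneg_nonneg) auto
    also have "\<dots> = 2 * (\<bar>u x\<bar> / norm x) * norm (g x)"
      using elim by (simp add: field_simps power2_eq_square)
    also have "\<dots> \<le> (\<bar>u x\<bar> / norm x)\<^sup>2 + (norm (g x))\<^sup>2"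
      by (rule sum_squares_bound)
    finally show ?case by (simp add: power_divide)
  qed
  have bR: "AE x in lborel. norm (?r n x) \<le> ?v x" for n
    using AE_lborel_nonzero
  proof eventually_elim
    case (elim x)
    note qq = q[OF elim, of n]
    have n1: "(norm x)\<^sup>2 * ?q n x \<le> 1"
      using mult_left_mono[OF qq(2), of "(norm x)\<^sup>2"] elim by simp
    have a: "(u x)\<^sup>2 * ?q n x \<le> (u x)\<^sup>2 / (norm x)\<^sup>2"
      using mult_left_mono[OF qq(2), of "(u x)\<^sup>2"] by simp
    have b: "(u x)\<^sup>2 * (norm x)\<^sup>2 * (?q n x)\<^sup>2 \<le> (u x)\<^sup>2 * ?q n x"
    proof -
      have "(u x)\<^sup>2 * (norm x)\<^sup>2 * (?q n x)\<^sup>2 = ((u x)\<^sup>2 * ?q n x) * ((norm x)\<^sup>2 * ?q n x)"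
        by (simp only: power2_eq_square mult_ac)
      also have "\<dots> \<le> ((u x)\<^sup>2 * ?q n x) * 1"
        using qq(1) by (intro mult_left_mono n1 mult_nonneg_nonneg) auto
      finally show ?thesis by simp
    qed
    have "norm (?r n x) \<le> real DIM('a) * ((u x)\<^sup>2 * ?q n x) + 2 * ((u x)\<^sup>2 * (norm x)\<^sup>2 * (?q n x)\<^sup>2)"
    proof -
      have "0 \<le> real DIM('a) * ((u x)\<^sup>2 * ?q n x)" "0 \<le> (u x)\<^sup>2 * (norm x)\<^sup>2 * (?q n x)\<^sup>2"
        using qq(1) by auto
      then show ?thesis by (simp add: abs_le_iff)
    qed
    also have "\<dots> \<le> real DIM('a) * ((u x)\<^sup>2 / (norm x)\<^sup>2) + 2 * ((u x)\<^sup>2 / (norm x)\<^sup>2)"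
      using a b by (intro add_mono mult_left_mono) auto
    finally show ?case by (simp only: distrib_right)
  qed
  show "integrable lborel ?L"
    by (rule integrable_dominated_convergence[OF mL ml w limL bL])
  have l: "(\<lambda>n. integral\<^sup>L lborel (?l n)) \<longlonglongrightarrow> integral\<^sup>L lborel ?L"
    by (rule integral_dominated_convergence[OF mL ml w limL bL])
  have "(\<lambda>n. integral\<^sup>L lborel (?r n)) \<longlonglongrightarrow> integral\<^sup>L lborel ?R"
    by (rule integral_dominated_convergence[OF mR mr v limR bR])
  moreover have "integral\<^sup>L lborel (?l n) = - integral\<^sup>L lborel (?r n)" for n
    by (rule integral_Euler_regularised(1)[OF u]) simp
  ultimately have "(\<lambda>n. integral\<^sup>L lborel (?l n)) \<longlonglongrightarrow> - integral\<^sup>L lborel ?R"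
    by (simp add: tendsto_minus del: integral_mult_right_zero)
  with l have "integral\<^sup>L lborel ?L = - integral\<^sup>L lborel ?R" by (rule LIMSEQ_unique)
  then show "integral\<^sup>L lborel ?L = - (real DIM('a) - 2) * (LINT x|lborel. (u x)\<^sup>2 / (norm x)\<^sup>2)"
    by (simp only: integral_mult_right_zero minus_mult_left)
qed

text \<open>With \<open>u = |x| powr (- (N - 2) / 2) * v\<close> this is \<open>|x| powr (- (N - 2) / 2)\<close> times the
  gradient of \<open>v\<close>, and its squared norm integrates to the Hardy deficit.\<close>

definition twisted_grad :: "('a::euclidean_space \<Rightarrow> real) \<Rightarrow> ('a \<Rightarrow> 'a) \<Rightarrow> 'a \<Rightarrow> 'a" where
  "twisted_grad u g x = g x + (((real DIM('a) - 2) / 2) * u x / (norm x)\<^sup>2) *\<^sub>R x"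

definition hardy_deficit :: "('a::euclidean_space \<Rightarrow> real) \<Rightarrow> ('a \<Rightarrow> 'a) \<Rightarrow> real" where
  "hardy_deficit u g = (LINT x|lborel. (norm (g x))\<^sup>2 - (real DIM('a) - 2)\<^sup>2 / (4 * (norm x)\<^sup>2) * (u x)\<^sup>2)"

lemma norm_twisted_grad:
  assumes "x \<noteq> 0"
  shows "(norm (twisted_grad u g x))\<^sup>2 = (norm (g x))\<^sup>2
     + ((real DIM('a::euclidean_space) - 2) / 2) * (2 * u x * ((x::'a) \<bullet> g x) / (norm x)\<^sup>2)
     + ((real DIM('a) - 2) / 2)\<^sup>2 * ((u x)\<^sup>2 / (norm x)\<^sup>2)"
proof -
  define k where "k = (real DIM('a) - 2) / 2"
  have "(norm (twisted_grad u g x))\<^sup>2 = (norm (g x))\<^sup>2 + 2 * (k * u x / (norm x)\<^sup>2) * (x \<bullet> g x) + (k * u x / (norm x)\<^sup>2)\<^sup>2 * (norm x)\<^sup>2"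
    unfolding power2_norm_eq_inner twisted_grad_def k_def[symmetric] by (simp add: inner_simps inner_commute power2_eq_square algebra_simps)
  also have "(k * u x / (norm x)\<^sup>2)\<^sup>2 * (norm x)\<^sup>2 = k\<^sup>2 * ((u x)\<^sup>2 / (norm x)\<^sup>2)"
    using assms by (simp add: field_simps power2_eq_square)
  finally show ?thesis unfolding k_def by simp
qed

text \<open>Since \<open>N - 2 = 2 k\<close>, the cross term integrates to \<open>- 2 k^2\<close>
  times the integral of \<open>u^2 / |x|^2\<close> and the last square contributes
  \<open>+ k^2\<close>; together they give the Hardy constant \<open>- k^2\<close>. In particular
  the deficit is nonnegative.\<close>

lemma hardy_deficit_eq:
  fixes u :: "'a::euclidean_space \<Rightarrow> real"
  assumes u: "C1_supported K u g" and N: "DIM('a) \<ge> 3"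
  shows "integrable lborel (\<lambda>x. (norm (twisted_grad u g x))\<^sup>2)"
    "hardy_deficit u g = (LINT x|lborel. (norm (twisted_grad u g x))\<^sup>2)"
proof -
  define k where "k = (real DIM('a) - 2) / 2"
  note d = C1_supportedD[OF u]
  have m: "u \<in> borel_measurable lborel" "g \<in> borel_measurable lborel"
    using d by (auto simp: borel_measurable_continuous_onI)
  note i1 = C1_supported_norm_grad_integrable(1)[OF u]
  note i2 = integral_radial_derivative[OF u N]
  note i3 = hardy_integrable[OF u N]
  let ?G = "\<lambda>x. (norm (g x))\<^sup>2 + k * (2 * u x * (x \<bullet> g x) / (norm x)\<^sup>2) + k\<^sup>2 * ((u x)\<^sup>2 / (norm x)\<^sup>2)"
  have iG: "integrable lborel ?G"
    by (intro Bochner_Integration.integrable_add integrable_mult_right i1 i2 i3)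
  have ae: "AE x in lborel. (norm (twisted_grad u g x))\<^sup>2 = ?G x"
    using AE_lborel_nonzero by eventually_elim (simp add: norm_twisted_grad k_def)
  have mG: "(\<lambda>x. (norm (twisted_grad u g x))\<^sup>2) \<in> borel_measurable lborel"
    unfolding twisted_grad_def using m by simp
  show "integrable lborel (\<lambda>x. (norm (twisted_grad u g x))\<^sup>2)"
    using integrable_cong_AE[OF mG _ ae] iG by simp
  have "(LINT x|lborel. (norm (twisted_grad u g x))\<^sup>2) = integral\<^sup>L lborel ?G"
    by (rule integral_cong_AE[OF mG _ ae]) (use iG in simp)
  also have "\<dots> = (LINT x|lborel. (norm (g x))\<^sup>2) + k * (LINT x|lborel. 2 * u x * (x \<bullet> g x) / (norm x)\<^sup>2)
      + k\<^sup>2 * (LINT x|lborel. (u x)\<^sup>2 / (norm x)\<^sup>2)"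
    by (subst Bochner_Integration.integral_add Bochner_Integration.integral_mult_right_zero
        | intro Bochner_Integration.integrable_add integrable_mult_right i1 i2 i3 refl)+
  also have "\<dots> = (LINT x|lborel. (norm (g x))\<^sup>2) - k\<^sup>2 * (LINT x|lborel. (u x)\<^sup>2 / (norm x)\<^sup>2)"
    unfolding i2(2) k_def by (simp add: power2_eq_square field_simps)
  also have "\<dots> = (LINT x|lborel. (norm (g x))\<^sup>2 - k\<^sup>2 * ((u x)\<^sup>2 / (norm x)\<^sup>2))"
    by (simp only: Bochner_Integration.integral_diff[OF i1 integrable_mult_right[OF i3]] integral_mult_right_zero)
  also have "\<dots> = hardy_deficit u g"
    unfolding hardy_deficit_def
    by (rule Bochner_Integration.integral_cong) (auto simp: k_def power_divide)
  finally show "hardy_deficit u g = (LINT x|lborel. (norm (twisted_grad u g x))\<^sup>2)" by simp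
qed

text \<open>A Poincare inequality for the deficit. It absorbs the terms in \<open>u^2\<close> that
  localisation near the boundary produces.\<close>

lemma hardy_deficit_ge_L2:
  fixes u :: "'a::euclidean_space \<Rightarrow> real"
  assumes u: "C1_supported K u g" and N: "DIM('a) \<ge> 3" and M: "M > 0" "K \<subseteq> cball 0 M"
  shows "(LINT x|lborel. (u x)\<^sup>2) \<le> M\<^sup>2 * hardy_deficit u g"
proof -
  define k where "k = (real DIM('a) - 2) / 2"
  define l where "l = 1 / M\<^sup>2"
  have l: "l > 0" using M by (simp add: l_def)
  note d = C1_supportedD[OF u]
  note hd = hardy_deficit_eq[OF u N]
  note i = C1_supported_norm_grad_integrable[OF u]
  have ix: "integrable lborel (\<lambda>x. x \<bullet> ((2 * u x) *\<^sub>R g x))"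
    using d by (auto intro!: integrable_continuous_compact_support[of K] continuous_intros)
  \<comment> \<open>The radial term integrates to \<open>- l N\<close> times the integral of
    \<open>u^2\<close>, with \<open>N = 2 k + 2\<close>. The singular part of
    \<open>twisted_grad\<close> returns \<open>2 l k\<close>, and \<open>l^2 |x|^2 \<le> l\<close>
    on \<open>K\<close> returns \<open>l\<close>, so exactly \<open>- l\<close> remains.\<close>
  have "0 \<le> (LINT x|lborel. (norm (twisted_grad u g x))\<^sup>2 + l * (x \<bullet> ((2 * u x) *\<^sub>R g x))
      + (2 * l * k + l) * (u x)\<^sup>2)"
  proof (rule integral_nonneg_AE)
    show "AE x in lborel. 0 \<le> (norm (twisted_grad u g x))\<^sup>2 + l * (x \<bullet> ((2 * u x) *\<^sub>R g x))
      + (2 * l * k + l) * (u x)\<^sup>2"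
      using AE_lborel_nonzero
    proof eventually_elim
      case (elim x)
      have b: "l\<^sup>2 * (norm x)\<^sup>2 * (u x)\<^sup>2 \<le> l * (u x)\<^sup>2"
      proof (cases "x \<in> K")
        case True
        then have "(norm x)\<^sup>2 \<le> M\<^sup>2" using M by (intro power_mono) auto
        then have "l * (norm x)\<^sup>2 \<le> 1" using M by (simp add: l_def)
        then have "l * (l * (norm x)\<^sup>2) * (u x)\<^sup>2 \<le> l * 1 * (u x)\<^sup>2"
          using l by (intro mult_right_mono mult_left_mono) auto
        then show ?thesis by (simp add: power2_eq_square algebra_simps)
      qed (use d in auto)
      have "0 \<le> (norm (twisted_grad u g x + (l * u x) *\<^sub>R x))\<^sup>2" by simp
      also have "\<dots> = (norm (twisted_grad u g x))\<^sup>2 + 2 * l * u x * (x \<bullet> twisted_grad u g x) + l\<^sup>2 * (norm x)\<^sup>2 * (u x)\<^sup>2"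
        unfolding power2_norm_eq_inner by (simp add: inner_simps inner_commute power2_eq_square algebra_simps)
      also have "x \<bullet> twisted_grad u g x = x \<bullet> g x + k * u x"
        using elim unfolding twisted_grad_def k_def by (simp add: inner_simps power2_norm_eq_inner)
      also have "(norm (twisted_grad u g x))\<^sup>2 + 2 * l * u x * (x \<bullet> g x + k * u x) + l\<^sup>2 * (norm x)\<^sup>2 * (u x)\<^sup>2
         \<le> (norm (twisted_grad u g x))\<^sup>2 + 2 * l * u x * (x \<bullet> g x + k * u x) + l * (u x)\<^sup>2"
        using b by simp
      finally show ?case by (simp add: algebra_simps power2_eq_square)
    qed
  qed
  also have "\<dots> = (LINT x|lborel. (norm (twisted_grad u g x))\<^sup>2) + l * (LINT x|lborel. x \<bullet> ((2 * u x) *\<^sub>R g x))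
      + (2 * l * k + l) * (LINT x|lborel. (u x)\<^sup>2)"
    by (subst Bochner_Integration.integral_add Bochner_Integration.integral_mult_right_zero
        | intro Bochner_Integration.integrable_add integrable_mult_right i ix hd(1) refl)+
  also have "\<dots> = hardy_deficit u g - l * (LINT x|lborel. (u x)\<^sup>2)"
    unfolding hd(2) integral_Euler[OF C1_supported_square[OF u]] k_def by (simp add: field_simps)
  finally show ?thesis using M by (simp add: l_def field_simps)
qed

subsection \<open>One-sided second-order properties of the distance function\<close>

lemma infdist_nearest_point:
  fixes F :: "'a::euclidean_space set"
  assumes "closed F" "F \<noteq> {}"
  obtains y where "y \<in> F" "infdist x F = norm (x - y)"
proof -
  obtain y where "y \<in> F" "\<And>z. z \<in> F \<Longrightarrow> dist x y \<le> dist x z"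
    using distance_attains_inf[OF assms, of x] by blast
  then have "infdist x F = dist x y"
    using assms(2) by (intro antisym infdist_le) (auto simp: infdist_notempty intro!: cINF_greatest)
  then show ?thesis using that \<open>y \<in> F\<close> by (simp add: dist_norm)
qed

lemma infdist_lipschitz: "1-lipschitz_on UNIV (\<lambda>x. infdist x F)"
  by (rule lipschitz_onI) (auto simp: dist_real_def infdist_triangle_abs)

text \<open>A nearest point \<open>y\<close> of \<open>x\<close> is an admissible competitor at both
  \<open>x + h\<close> and \<open>x - h\<close>. The parallelogram law gives the sum of the squares
  of the two distances to \<open>y\<close>, and \<open>2 a r \<le> a^2 + r^2\<close> linearises each
  of them at \<open>r = norm (x - y)\<close>.\<close>

lemma infdist_second_difference:
  fixes F :: "'a::euclidean_space set"
  assumes "closed F" "F \<noteq> {}" "infdist x F > 0"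
  shows "infdist (x + h) F + infdist (x - h) F - 2 * infdist x F \<le> (norm h)\<^sup>2 / infdist x F"
proof -
  obtain y where y: "y \<in> F" "infdist x F = norm (x - y)"
    using infdist_nearest_point[OF assms(1,2)] .
  define r p a b where "r = norm (x - y)" and "p = norm h" and "a = norm (x - y + h)" and "b = norm (x - y - h)"
  have r: "r > 0" using assms(3) y by (simp add: r_def)
  have "infdist (x + h) F \<le> a" "infdist (x - h) F \<le> b"
    using infdist_le[OF y(1), of "x + h"] infdist_le[OF y(1), of "x - h"]
    by (simp_all add: dist_norm a_def b_def algebra_simps)
  moreover have "a + b \<le> 2 * r + p\<^sup>2 / r"
  proof -
    have "a\<^sup>2 + b\<^sup>2 = 2 * r\<^sup>2 + 2 * p\<^sup>2"
      unfolding a_def b_def r_def p_def power2_norm_eq_inner by (simp add: inner_simps inner_commute)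
    moreover have "0 \<le> (a - r)\<^sup>2" "0 \<le> (b - r)\<^sup>2" by auto
    ultimately have "2 * (a + b) * r \<le> 4 * r\<^sup>2 + 2 * p\<^sup>2"
      by (simp add: power2_diff algebra_simps)
    then show ?thesis using r by (simp add: field_simps power2_eq_square)
  qed
  ultimately show ?thesis unfolding y(2) r_def[symmetric] p_def[symmetric] by simp
qed

text \<open>The difference quotients are tested in the direction \<open>D\<close> itself.\<close>

lemma norm_GDERIV_le_lipschitz:
  fixes f :: "'a::euclidean_space \<Rightarrow> real"
  assumes "L-lipschitz_on UNIV f" "GDERIV f x :> D"
  shows "norm D \<le> L"
proof -
  have "(\<lambda>n. dquot f D n x) \<longlonglongrightarrow> D \<bullet> D" by (rule dquot_tendsto[OF assms(2)])
  then have "D \<bullet> D \<le> L * norm D"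
    using dquot_bound[OF assms(1), of D] by (intro LIMSEQ_le_const2) (auto simp: abs_le_iff)
  then show ?thesis
    using lipschitz_on_nonneg[OF assms(1)]
    by (cases "D = 0") (auto simp: power2_norm_eq_inner[symmetric] power2_eq_square)
qed

text \<open>Moving from \<open>x\<close> straight towards a nearest point \<open>y\<close> decreases
  the distance at unit speed, so the slope along \<open>y - x\<close> is at most
  \<open>- norm (x - y)\<close>. With \<open>norm_GDERIV_le_lipschitz\<close> this is the eikonal
  equation wherever the distance is differentiable.\<close>

lemma norm_GDERIV_infdist_ge:
  fixes F :: "'a::euclidean_space set"
  assumes "closed F" "F \<noteq> {}" "infdist x F > 0" "GDERIV (\<lambda>x. infdist x F) x :> D"
  shows "1 \<le> norm D"
proof -
  obtain y where y: "y \<in> F" "infdist x F = norm (x - y)"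
    using infdist_nearest_point[OF assms(1,2)] .
  have "(\<lambda>n. dquot (\<lambda>x. infdist x F) (y - x) n x) \<longlonglongrightarrow> D \<bullet> (y - x)"
    by (rule dquot_tendsto[OF assms(4)])
  moreover have "dquot (\<lambda>x. infdist x F) (y - x) n x \<le> - norm (x - y)" for n
  proof -
    define t where "t = 1 / real (Suc n)"
    have t: "0 < t" "t \<le> 1" by (auto simp: t_def)
    have "infdist (x + t *\<^sub>R (y - x)) F \<le> dist (x + t *\<^sub>R (y - x)) y" by (rule infdist_le[OF y(1)])
    also have "x + t *\<^sub>R (y - x) - y = (1 - t) *\<^sub>R (x - y)" by (simp add: algebra_simps)
    then have "dist (x + t *\<^sub>R (y - x)) y = (1 - t) * norm (x - y)"
      using t by (simp add: dist_norm)
    finally have "infdist (x + t *\<^sub>R (y - x)) F - infdist x F \<le> - t * norm (x - y)"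
      by (simp add: y(2) algebra_simps)
    then have "real (Suc n) * (infdist (x + t *\<^sub>R (y - x)) F - infdist x F) \<le> real (Suc n) * (- t * norm (x - y))"
      by (intro mult_left_mono) auto
    also have "\<dots> = - norm (x - y)" by (simp add: t_def)
    finally show ?thesis by (simp add: dquot_def t_def)
  qed
  ultimately have "D \<bullet> (y - x) \<le> - norm (x - y)"
    by (intro LIMSEQ_le_const2) auto
  moreover have "- (D \<bullet> (y - x)) \<le> norm D * norm (x - y)"
    using Cauchy_Schwarz_ineq2[of D "y - x"] by (simp add: norm_minus_commute abs_le_iff)
  ultimately have "1 * norm (x - y) \<le> norm D * norm (x - y)" by linarith
  then show ?thesis using y assms(3) by (auto simp: mult_le_cancel_right)
qed

section \<open>Second difference quotients and a one-sided bound for the Laplacian\<close>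

definition dquot2 :: "('a::euclidean_space \<Rightarrow> real) \<Rightarrow> 'a \<Rightarrow> nat \<Rightarrow> 'a \<Rightarrow> real" where
  "dquot2 f e n x = (real (Suc n))\<^sup>2 *
     (f (x + (1 / real (Suc n)) *\<^sub>R e) + f (x - (1 / real (Suc n)) *\<^sub>R e) - 2 * f x)"

text \<open>One use of l'Hopital's rule turns the symmetric second quotient of \<open>f\<close> into
  a symmetric first quotient of \<open>g\<close>, whose limit follows from differentiability of
  \<open>g\<close> at the single point \<open>x\<close>.\<close>

lemma dquot2_tendsto:
  fixes f :: "'a::euclidean_space \<Rightarrow> real"
  assumes ev: "\<forall>\<^sub>F y in nhds x. GDERIV f y :> g y"
    and g: "(g has_derivative D) (at x)"
  shows "(\<lambda>n. dquot2 f e n x) \<longlonglongrightarrow> D e \<bullet> e"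
proof -
  let ?f0 = "\<lambda>t. f (x + t *\<^sub>R e) + f (x - t *\<^sub>R e) - 2 * f x"
  let ?f' = "\<lambda>t. g (x + t *\<^sub>R e) \<bullet> e - g (x - t *\<^sub>R e) \<bullet> e"
  have tp: "((\<lambda>t. x + t *\<^sub>R e) has_derivative (\<lambda>s. s *\<^sub>R e)) (at t)" for t
    by (auto intro!: derivative_eq_intros)
  have tm: "((\<lambda>t. x - t *\<^sub>R e) has_derivative (\<lambda>s. - (s *\<^sub>R e))) (at t)" for t
    by (auto intro!: derivative_eq_intros)
  have lp: "((\<lambda>t. x + t *\<^sub>R e) \<longlongrightarrow> x) (at_right 0)" and lm: "((\<lambda>t. x - t *\<^sub>R e) \<longlongrightarrow> x) (at_right 0)"
    by (auto intro!: tendsto_eq_intros)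
  have evp: "\<forall>\<^sub>F t in at_right 0. GDERIV f (x + t *\<^sub>R e) :> g (x + t *\<^sub>R e)"
    using ev lp by (rule eventually_compose_filterlim)
  have evm: "\<forall>\<^sub>F t in at_right 0. GDERIV f (x - t *\<^sub>R e) :> g (x - t *\<^sub>R e)"
    using ev lm by (rule eventually_compose_filterlim)
  have fx: "isCont f x"
    using eventually_nhds_x_imp_x[OF ev] unfolding gderiv_def by (rule has_derivative_continuous)
  have lim: "((\<lambda>t. ?f0 t / t\<^sup>2) \<longlongrightarrow> D e \<bullet> e) (at_right 0)"
  proof (rule lhopital_right_0)
    have "((\<lambda>t. f (x + t *\<^sub>R e)) \<longlongrightarrow> f x) (at_right 0)" "((\<lambda>t. f (x - t *\<^sub>R e)) \<longlongrightarrow> f x) (at_right 0)"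
      using isCont_tendsto_compose[OF fx lp] isCont_tendsto_compose[OF fx lm] by auto
    then have "(?f0 \<longlongrightarrow> f x + f x - 2 * f x) (at_right 0)" by (intro tendsto_intros)
    then show "(?f0 \<longlongrightarrow> 0) (at_right 0)" by simp
    show "((\<lambda>t::real. t\<^sup>2) \<longlongrightarrow> 0) (at_right 0)" by (auto intro!: tendsto_eq_intros)
    show "\<forall>\<^sub>F t in at_right 0. t\<^sup>2 \<noteq> (0::real)" "\<forall>\<^sub>F t in at_right 0. 2 * t \<noteq> (0::real)"
      by (auto intro!: eventually_at_rightI[of 0 1])
    show "\<forall>\<^sub>F t in at_right 0. ((\<lambda>t. t\<^sup>2) has_real_derivative 2 * t) (at t)"
      by (auto intro!: always_eventually derivative_eq_intros)
    show "\<forall>\<^sub>F t in at_right 0. (?f0 has_real_derivative ?f' t) (at t)"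
      using evp evm
    proof eventually_elim
      case (elim t)
      have "((\<lambda>t. f (x + t *\<^sub>R e)) has_derivative (\<lambda>s. (s *\<^sub>R e) \<bullet> g (x + t *\<^sub>R e))) (at t)"
        using has_derivative_compose[OF tp elim(1)[unfolded gderiv_def]] .
      moreover have "((\<lambda>t. f (x - t *\<^sub>R e)) has_derivative (\<lambda>s. (- (s *\<^sub>R e)) \<bullet> g (x - t *\<^sub>R e))) (at t)"
        using has_derivative_compose[OF tm elim(2)[unfolded gderiv_def]] .
      ultimately have "(?f0 has_derivative (\<lambda>s. (s *\<^sub>R e) \<bullet> g (x + t *\<^sub>R e) + (- (s *\<^sub>R e)) \<bullet> g (x - t *\<^sub>R e) - 0)) (at t)"
        by (intro has_derivative_diff has_derivative_add has_derivative_const)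
      then show ?case unfolding has_field_derivative_def
        by (rule has_derivative_subst) (auto simp: fun_eq_iff inner_commute algebra_simps)
    qed
    have gp: "((\<lambda>t. g (x + t *\<^sub>R e)) has_derivative (\<lambda>s. D (s *\<^sub>R e))) (at 0)"
      using has_derivative_compose[OF tp[of 0], of g D] g by simp
    have gm: "((\<lambda>t. g (x - t *\<^sub>R e)) has_derivative (\<lambda>s. D (- (s *\<^sub>R e)))) (at 0)"
      using has_derivative_compose[OF tm[of 0], of g D] g by simp
    have "(?f' has_derivative (\<lambda>s. D (s *\<^sub>R e) \<bullet> e - D (- (s *\<^sub>R e)) \<bullet> e)) (at 0)"
      by (intro has_derivative_diff has_derivative_inner_left gp gm)
    then have "(?f' has_field_derivative (2 * (D e \<bullet> e))) (at 0)"
      unfolding has_field_derivative_def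
      by (rule has_derivative_subst)
        (use has_derivative_linear[OF g] in \<open>auto simp: fun_eq_iff linear_scale linear_neg algebra_simps\<close>)
    then have "((\<lambda>t. ?f' t / t) \<longlongrightarrow> 2 * (D e \<bullet> e)) (at 0)"
      unfolding DERIV_def by simp
    then have "((\<lambda>t. ?f' t / t / 2) \<longlongrightarrow> 2 * (D e \<bullet> e) / 2) (at_right 0)"
      by (intro tendsto_divide tendsto_const) (auto intro: tendsto_within_subset)
    then show "((\<lambda>t. ?f' t / (2 * t)) \<longlongrightarrow> D e \<bullet> e) (at_right 0)"
      by (simp add: mult.commute)
  qed
  have "filterlim (\<lambda>n. 1 / real (Suc n)) (at_right 0) sequentially"
    unfolding filterlim_at using LIMSEQ_inverse_real_of_nat by (auto simp: inverse_eq_divide)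
  from filterlim_compose[OF lim this] show ?thesis
    by (simp add: dquot2_def[abs_def] power_divide mult.commute)
qed

text \<open>Discrete integration by parts: the second difference is a forward difference minus a
  backward one, and translating the backward half by the step moves a difference onto
  \<open>p\<close>.\<close>

lemma dquot2_integral:
  fixes f p :: "'a::euclidean_space \<Rightarrow> real"
  assumes f: "continuous_on UNIV f" and p: "continuous_on UNIV p" "\<And>x. x \<notin> cball 0 R \<Longrightarrow> p x = 0"
  shows "(LINT x|lborel. p x * dquot2 f e n x) = - (LINT x|lborel. dquot f e n x * dquot p e n x)"
    "integrable lborel (\<lambda>x. p x * dquot2 f e n x)"
proof -
  define c where "c = real (Suc n)"
  define a where "a = (1 / real (Suc n)) *\<^sub>R e"
  have fa: "continuous_on UNIV (\<lambda>x. f (x + b))" for b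
    by (rule continuous_on_compose2[OF f]) (auto intro!: continuous_intros)
  have fm: "continuous_on UNIV (\<lambda>x. f (x - b))" for b
    by (rule continuous_on_compose2[OF f]) (auto intro!: continuous_intros)
  have pa: "continuous_on UNIV (\<lambda>x. p (x + b))" for b
    by (rule continuous_on_compose2[OF p(1)]) (auto intro!: continuous_intros)
  have i1: "integrable lborel (\<lambda>x. p x * (f (x + a) - f x))"
    by (rule integrable_continuous_compact_support[of "cball 0 R"]) (auto intro!: continuous_intros fa f p)
  have i2: "integrable lborel (\<lambda>x. p x * (f x - f (x - a)))"
    by (rule integrable_continuous_compact_support[of "cball 0 R"]) (auto intro!: continuous_intros fm f p)
  note t = integral_translate[OF i2, of a]
  have "integrable lborel (\<lambda>x. c\<^sup>2 * (p x * (f (x + a) - f x) - p x * (f x - f (x - a))))"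
    using i1 i2 by simp
  moreover have eq: "(\<lambda>x. c\<^sup>2 * (p x * (f (x + a) - f x) - p x * (f x - f (x - a)))) = (\<lambda>x. p x * dquot2 f e n x)"
    unfolding dquot2_def a_def[symmetric] unfolding c_def[symmetric] by (auto simp: fun_eq_iff algebra_simps)
  ultimately show "integrable lborel (\<lambda>x. p x * dquot2 f e n x)" by simp
  have "(LINT x|lborel. p x * dquot2 f e n x)
     = c\<^sup>2 * ((LINT x|lborel. p x * (f (x + a) - f x)) - (LINT x|lborel. p x * (f x - f (x - a))))"
    unfolding eq[symmetric] using i1 i2 by simp
  also have "(LINT x|lborel. p x * (f x - f (x - a))) = (LINT x|lborel. p (x + a) * (f (x + a) - f x))"
    using t(2) by simp
  also have "c\<^sup>2 * ((LINT x|lborel. p x * (f (x + a) - f x)) - (LINT x|lborel. p (x + a) * (f (x + a) - f x)))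
    = (LINT x|lborel. c\<^sup>2 * (p x * (f (x + a) - f x) - p (x + a) * (f (x + a) - f x)))"
    using i1 t(1) by simp
  also have "\<dots> = (LINT x|lborel. - (dquot f e n x * dquot p e n x))"
    unfolding dquot_def a_def[symmetric] unfolding c_def[symmetric]
    by (rule Bochner_Integration.integral_cong) (auto simp: power2_eq_square algebra_simps)
  finally show "(LINT x|lborel. p x * dquot2 f e n x) = - (LINT x|lborel. dquot f e n x * dquot p e n x)"
    by simp
qed

text \<open>The conclusion says that the distributional Laplacian of \<open>f\<close>, tested
  against \<open>p \<ge> 0\<close>, is at most \<open>\<phi>\<close>, although \<open>\<phi>\<close>
  bounds only its pointwise values almost everywhere. After discrete integration by parts the left
  side is a limit of integrals of \<open>p\<close> times second quotients. Semiconcavity bounds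
  these quotients from above, so Fatou's lemma allows mass to disappear in one direction only, the
  one that preserves the inequality.\<close>

lemma weak_laplacian_le:
  fixes f p \<phi> :: "'a::euclidean_space \<Rightarrow> real"
  assumes f: "L-lipschitz_on UNIV f" and p: "M-lipschitz_on UNIV p"
    and K: "bounded K" "\<And>x. x \<notin> K \<Longrightarrow> p x = 0" and p0: "\<And>x. 0 \<le> p x"
    and semiconcave: "\<And>x h. x \<in> K \<Longrightarrow> f (x + h) + f (x - h) - 2 * f x \<le> C * (norm h)\<^sup>2"
    and mf: "gf \<in> borel_measurable lborel" and mp: "gp \<in> borel_measurable lborel"
    and gf: "AE x in lborel. x \<in> K \<longrightarrow> GDERIV f x :> gf x"
    and gp: "AE x in lborel. GDERIV p x :> gp x" "\<And>x. x \<notin> K \<Longrightarrow> gp x = 0"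
    and lap: "AE x in lborel. x \<in> K \<longrightarrow> (\<exists>l \<le> \<phi> x. (\<lambda>n. \<Sum>b\<in>Basis. dquot2 f b n x) \<longlonglongrightarrow> l)"
    and phi: "integrable lborel (\<lambda>x. \<phi> x * p x)"
  shows "integrable lborel (\<lambda>x. gf x \<bullet> gp x)"
    "- (LINT x|lborel. \<phi> x * p x) \<le> (LINT x|lborel. gf x \<bullet> gp x)"
proof -
  obtain R where "K \<subseteq> cball 0 R"
    using \<open>bounded K\<close> by (auto simp: bounded_iff subset_iff)
  with K have R: "\<And>x. x \<notin> cball 0 R \<Longrightarrow> p x = 0" by blast
  have fc: "continuous_on UNIV f" and pc: "continuous_on UNIV p"
    using f p by (auto intro: lipschitz_on_continuous_on)
  have pint: "integrable lborel p"
    by (rule integrable_continuous_compact_support[OF compact_cball pc R])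
  have lim1: "integrable lborel (\<lambda>x. (gf x \<bullet> b) * (gp x \<bullet> b)) \<and>
     (\<lambda>n. LINT x|lborel. dquot f b n x * dquot p b n x) \<longlonglongrightarrow> (LINT x|lborel. (gf x \<bullet> b) * (gp x \<bullet> b))" for b
  proof -
    let ?w = "\<lambda>x. (L * norm b) * (M * norm b) * indicator (cball 0 (R + norm b)) x"
    have w: "integrable lborel ?w"
      by (intro integrable_mult_right integrable_real_indicator emeasure_bounded_finite) auto
    have LM: "0 \<le> L * norm b" "0 \<le> M * norm b"
      using lipschitz_on_nonneg[OF f] lipschitz_on_nonneg[OF p] by auto
    have bd: "AE x in lborel. norm (dquot f b n x * dquot p b n x) \<le> ?w x" for n
    proof (rule AE_I2)
      fix x
      show "norm (dquot f b n x * dquot p b n x) \<le> ?w x"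
      proof (cases "x \<in> cball 0 (R + norm b)")
        case True
        have "norm (dquot f b n x * dquot p b n x) \<le> (L * norm b) * (M * norm b)"
          unfolding real_norm_def abs_mult
          using dquot_bound[OF f, where e=b and n=n and x=x] dquot_bound[OF p, where e=b and n=n and x=x] LM by (intro mult_mono) auto
        with True show ?thesis by simp
      next
        case False
        then show ?thesis using dquot_supported[OF R False, where n=n] by simp
      qed
    qed
    have lim: "AE x in lborel. (\<lambda>n. dquot f b n x * dquot p b n x) \<longlonglongrightarrow> (gf x \<bullet> b) * (gp x \<bullet> b)"
      using gf gp(1)
    proof eventually_elim
      case (elim x)
      note tp = dquot_tendsto[OF elim(2), of b]
      show ?case
      proof (cases "x \<in> K")
        case True
        then show ?thesis using elim(1) by (intro tendsto_mult tp dquot_tendsto) auto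
      next
        case False
        \<comment> \<open>Nothing is known about derivatives of \<open>f\<close> off
          \<open>K\<close>, but its quotients stay bounded while those of \<open>p\<close> tend to
          zero.\<close>
        have "(\<lambda>n. dquot p b n x) \<longlonglongrightarrow> 0" using tp gp(2)[OF False] by simp
        then have "(\<lambda>n. (L * norm b) * \<bar>dquot p b n x\<bar>) \<longlonglongrightarrow> 0"
          by (intro tendsto_mult_right_zero tendsto_rabs_zero)
        then have "(\<lambda>n. dquot f b n x * dquot p b n x) \<longlonglongrightarrow> 0"
          by (rule Lim_null_comparison[rotated])
            (auto simp: abs_mult intro!: always_eventually mult_right_mono dquot_bound[OF f])
        then show ?thesis using gp(2)[OF False] by simp
      qed
    qed
    have m: "(\<lambda>x. (gf x \<bullet> b) * (gp x \<bullet> b)) \<in> borel_measurable lborel" using mf mp by simp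
    have mn: "(\<lambda>x. dquot f b n x * dquot p b n x) \<in> borel_measurable lborel" for n
      using dquot_measurable[OF fc, of b n] dquot_measurable[OF pc, of b n] by simp
    show ?thesis
      using integrable_dominated_convergence[OF m mn w lim bd] integral_dominated_convergence[OF m mn w lim bd] by blast
  qed
  have ip: "gf x \<bullet> gp x = (\<Sum>b\<in>Basis. (gf x \<bullet> b) * (gp x \<bullet> b))" for x
    by (rule euclidean_inner)
  show int: "integrable lborel (\<lambda>x. gf x \<bullet> gp x)"
    unfolding ip using lim1 by auto
  have ie: "(LINT x|lborel. gf x \<bullet> gp x) = (\<Sum>b\<in>Basis. LINT x|lborel. (gf x \<bullet> b) * (gp x \<bullet> b))"
    unfolding ip using lim1 by (intro Bochner_Integration.integral_sum) auto
  define N where "N = real DIM('a)"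
  \<comment> \<open>Each of the \<open>N\<close> second quotients is at most \<open>C\<close> on
    \<open>K\<close>, so the summand \<open>N * C * p x\<close> makes \<open>F\<close>
    nonnegative.\<close>
  define F where "F n x = N * C * p x - (\<Sum>b\<in>Basis. p x * dquot2 f b n x)" for n x
  have iF: "integrable lborel (F n)" for n
    unfolding F_def using pint dquot2_integral(2)[OF fc pc R] by auto
  have "integral\<^sup>L lborel (F n) = N * C * integral\<^sup>L lborel p + (\<Sum>b\<in>Basis. LINT x|lborel. dquot f b n x * dquot p b n x)" for n
    unfolding F_def using pint dquot2_integral[OF fc pc R] by (simp add: sum_negf)
  then have limF: "(\<lambda>n. integral\<^sup>L lborel (F n)) \<longlonglongrightarrow> N * C * integral\<^sup>L lborel p + (LINT x|lborel. gf x \<bullet> gp x)"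
    unfolding ie using lim1 by (auto intro!: tendsto_intros)
  have dq: "dquot2 f b n x \<le> C" if "x \<in> K" "b \<in> Basis" for b n x
  proof -
    have "dquot2 f b n x \<le> (real (Suc n))\<^sup>2 * (C * (norm ((1 / real (Suc n)) *\<^sub>R b))\<^sup>2)"
      unfolding dquot2_def by (intro mult_left_mono semiconcave that) auto
    also have "\<dots> = C" using that by (simp add: power_divide)
    finally show ?thesis .
  qed
  have F0: "0 \<le> F n x" for n x
  proof (cases "x \<in> K")
    case True
    have "(\<Sum>b\<in>Basis. p x * dquot2 f b n x) \<le> (\<Sum>b\<in>(Basis::'a set). p x * C)"
      using dq[OF True] p0 by (intro sum_mono mult_left_mono) auto
    then show ?thesis by (simp add: F_def N_def mult_ac)
  qed (simp add: F_def K(2))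
  \<comment> \<open>This is what \<open>F n\<close> would tend to if the pointwise Laplacian were
    exactly \<open>\<phi>\<close>. As the Laplacian is at most \<open>\<phi>\<close>, the limit of
    \<open>F n\<close> is at least \<open>l\<close> almost everywhere.\<close>
  define l where "l x = N * C * p x - \<phi> x * p x" for x
  have il: "integrable lborel l" unfolding l_def using pint phi by simp
  \<comment> \<open>Only the negative parts of \<open>F n - l\<close> are dominated, as in Fatou's lemma; this avoids
    any assumption on the size or measurability of the pointwise Laplacian.\<close>
  have "(\<lambda>n. LINT x|lborel. max 0 (l x - F n x)) \<longlonglongrightarrow> (LINT x|(lborel :: 'a measure). (0::real))"
  proof (rule integral_dominated_convergence)
    show "integrable lborel (\<lambda>x. \<bar>l x\<bar>)" using il by simp
    show "(\<lambda>x. max 0 (l x - F n x)) \<in> borel_measurable lborel" for n using il iF[of n] by simp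
    show "AE x in lborel. norm (max 0 (l x - F n x)) \<le> \<bar>l x\<bar>" for n
    proof (rule AE_I2)
      show "norm (max 0 (l x - F n x)) \<le> \<bar>l x\<bar>" for x using F0[of n x] by auto
    qed
    show "AE x in lborel. (\<lambda>n. max 0 (l x - F n x)) \<longlonglongrightarrow> 0"
      using lap
    proof eventually_elim
      case (elim x)
      show ?case
      proof (cases "x \<in> K")
        case True
        then obtain c where c: "c \<le> \<phi> x" "(\<lambda>n. \<Sum>b\<in>Basis. dquot2 f b n x) \<longlonglongrightarrow> c" using elim by blast
        have "(\<lambda>n. max 0 (l x - (N * C * p x - p x * (\<Sum>b\<in>Basis. dquot2 f b n x)))) \<longlonglongrightarrow> max 0 (l x - (N * C * p x - p x * c))"
          by (intro tendsto_intros c)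
        moreover have "p x * c \<le> p x * \<phi> x" by (intro mult_left_mono c p0)
        then have "max 0 (l x - (N * C * p x - p x * c)) = 0" by (simp add: l_def mult.commute)
        ultimately show ?thesis by (simp add: F_def sum_distrib_left)
      qed (simp add: F_def l_def K(2))
    qed
  qed auto
  then have "(\<lambda>n. integral\<^sup>L lborel (F n) + (LINT x|lborel. max 0 (l x - F n x))) \<longlonglongrightarrow>
      N * C * integral\<^sup>L lborel p + (LINT x|lborel. gf x \<bullet> gp x) + 0"
    by (intro tendsto_add limF) simp
  moreover have "integral\<^sup>L lborel l \<le> integral\<^sup>L lborel (F n) + (LINT x|lborel. max 0 (l x - F n x))" for n
  proof -
    have i: "integrable lborel (\<lambda>x. max 0 (l x - F n x))" using il iF[of n] by simp
    have "integral\<^sup>L lborel l \<le> (LINT x|lborel. F n x + max 0 (l x - F n x))"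
      using il iF[of n] i by (intro integral_mono) auto
    also have "\<dots> = integral\<^sup>L lborel (F n) + (LINT x|lborel. max 0 (l x - F n x))"
      using iF i by simp
    finally show ?thesis .
  qed
  ultimately have "integral\<^sup>L lborel l \<le> N * C * integral\<^sup>L lborel p + (LINT x|lborel. gf x \<bullet> gp x) + 0"
    by (intro LIMSEQ_le_const) auto
  moreover have "integral\<^sup>L lborel l = N * C * integral\<^sup>L lborel p - (LINT x|lborel. \<phi> x * p x)"
    unfolding l_def using pint phi by simp
  ultimately show "- (LINT x|lborel. \<phi> x * p x) \<le> (LINT x|lborel. gf x \<bullet> gp x)" by simp
qed

subsection \<open>The Hardy inequality near the boundary\<close>

lemma compact_bdist_lower_bound:
  fixes \<Omega> :: "'a::euclidean_space set"
  assumes "compact K" "K \<inter> frontier \<Omega> = {}" "frontier \<Omega> \<noteq> {}"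
  shows "\<exists>\<delta>>0. \<forall>x\<in>K. \<delta> \<le> bdist \<Omega> x"
proof (cases "K = {}")
  case True
  then show ?thesis by (auto intro: exI[of _ 1])
next
  case False
  have c: "continuous_on K (bdist \<Omega>)"
    unfolding bdist_def[abs_def] by (intro continuous_intros)
  obtain x where x: "x \<in> K" "\<And>y. y \<in> K \<Longrightarrow> bdist \<Omega> x \<le> bdist \<Omega> y"
    using continuous_attains_inf[OF assms(1) False c] by blast
  have "x \<notin> frontier \<Omega>" using x assms(2) by auto
  then have "bdist \<Omega> x \<noteq> 0"
    unfolding bdist_def using in_closed_iff_infdist_zero[OF frontier_closed assms(3)] by blast
  then have "bdist \<Omega> x > 0" using infdist_nonneg[of x "frontier \<Omega>"] unfolding bdist_def by linarith
  then show ?thesis using x(2) by blast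
qed

lemma bdist_measurable: "bdist \<Omega> \<in> borel_measurable lborel"
  unfolding bdist_def[abs_def] by (simp add: borel_measurable_continuous_onI continuous_intros)

lemma open_Int_frontier_empty: "open \<Omega> \<Longrightarrow> \<Omega> \<inter> frontier \<Omega> = {}"
  by (auto simp: frontier_def interior_open)

lemma integrable_div_bdist_squared:
  fixes \<Omega> :: "'a::euclidean_space set"
  assumes u: "C1_supported K u g" and K: "K \<subseteq> \<Omega>" and O: "open \<Omega>" "frontier \<Omega> \<noteq> {}"
  shows "integrable lborel (\<lambda>x. (u x)\<^sup>2 / (bdist \<Omega> x)\<^sup>2)"
proof -
  note d = C1_supportedD[OF u]
  have "K \<inter> frontier \<Omega> = {}" using open_Int_frontier_empty[OF O(1)] K by blast
  from compact_bdist_lower_bound[OF d(1) this O(2)]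
  obtain \<delta> where \<delta>: "\<delta> > 0" "\<And>x. x \<in> K \<Longrightarrow> \<delta> \<le> bdist \<Omega> x" by blast
  obtain B where B: "\<And>x. \<bar>u x\<bar> \<le> B" using C1_supported_bounded[OF u] by metis
  have um: "u \<in> borel_measurable lborel" using d(6) by (simp add: borel_measurable_continuous_onI)
  show ?thesis
  proof (rule integrable_bounded_support[OF _ compact_imp_bounded[OF d(1)]])
    show "(\<lambda>x. (u x)\<^sup>2 / (bdist \<Omega> x)\<^sup>2) \<in> borel_measurable lborel"
      using um bdist_measurable[of \<Omega>] by simp
    show "(u x)\<^sup>2 / (bdist \<Omega> x)\<^sup>2 = 0" if "x \<notin> K" for x using d(5) that by simp
    show "\<bar>(u x)\<^sup>2 / (bdist \<Omega> x)\<^sup>2\<bar> \<le> B\<^sup>2 / \<delta>\<^sup>2" if "x \<in> K" for x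
    proof -
      have "(u x)\<^sup>2 / (bdist \<Omega> x)\<^sup>2 \<le> B\<^sup>2 / \<delta>\<^sup>2"
        using \<delta>(1) \<delta>(2)[OF that] power_mono[OF B[of x], of 2] by (intro frac_le) (auto intro: power_mono)
      then show ?thesis by simp
    qed
  qed
qed

section \<open>The one-dimensional Hardy inequality in a boundary chart\<close>

text \<open>Put \<open>w = v / \<rho>\<close>. Because \<open>\<rho>\<close> has slope 1 along
  \<open>e\<close>, the derivative of \<open>v^2 / \<rho>\<close> along \<open>e\<close> is
  \<open>2 w (gv \<bullet> e) - w^2\<close>, and its integral vanishes. Young's inequality then
  absorbs half of \<open>w^2\<close>, which produces the classical factor 4.\<close>

lemma hardy_along_direction:
  fixes v \<rho> :: "'a::euclidean_space \<Rightarrow> real"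
  assumes v: "C1_supported K v gv"
    and \<rho>: "\<And>x. GDERIV \<rho> x :> g\<rho> x" "continuous_on UNIV g\<rho>" "\<And>x. g\<rho> x \<bullet> e = 1"
    and pos: "\<And>x. x \<in> K \<Longrightarrow> \<rho> x > 0"
  shows "integrable lborel (\<lambda>x. (v x / \<rho> x)\<^sup>2)"
    "(LINT x|lborel. (v x / \<rho> x)\<^sup>2) \<le> 4 * (LINT x|lborel. (gv x \<bullet> e)\<^sup>2)"
proof -
  note d = C1_supportedD[OF v]
  have \<rho>c: "continuous_on UNIV \<rho>"
    using \<rho>(1) unfolding gderiv_def
    by (meson continuous_at_imp_continuous_on has_derivative_continuous)
  define U where "U = {x. \<rho> x > 0}"
  have U: "open U" "K \<subseteq> U"
    using pos unfolding U_def by (auto intro!: open_Collect_less continuous_intros \<rho>c)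
  have Gq: "GDERIV (\<lambda>x. inverse (\<rho> x)) x :> - (inverse (\<rho> x))\<^sup>2 *\<^sub>R g\<rho> x" if "x \<in> U" for x
    using that \<rho>(1) by (intro GDERIV_inverse) (auto simp: U_def)
  have cq: "continuous_on U (\<lambda>x. - (inverse (\<rho> x))\<^sup>2 *\<^sub>R g\<rho> x)"
    by (intro continuous_intros continuous_on_subset[OF \<rho>c] continuous_on_subset[OF \<rho>(2)])
      (auto simp: U_def)
  define w where "w x = v x * inverse (\<rho> x)" for x
  have "continuous_on UNIV w"
    unfolding w_def[abs_def] by (rule C1_supportedD(6)[OF C1_supported_mult[OF v U cq Gq]])
  then have iw: "integrable lborel (\<lambda>x. (w x)\<^sup>2)" and iwg: "integrable lborel (\<lambda>x. 2 * w x * (gv x \<bullet> e))"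
    and ig: "integrable lborel (\<lambda>x. (gv x \<bullet> e)\<^sup>2)"
    using d by (auto intro!: integrable_continuous_compact_support[of K] continuous_intros simp: w_def)
  note S = C1_supported_mult[OF C1_supported_square[OF v] U cq Gq]
  have "((v x)\<^sup>2 *\<^sub>R (- (inverse (\<rho> x))\<^sup>2 *\<^sub>R g\<rho> x) + inverse (\<rho> x) *\<^sub>R ((2 * v x) *\<^sub>R gv x)) \<bullet> e
      = 2 * w x * (gv x \<bullet> e) - (w x)\<^sup>2" for x
    by (simp add: inner_simps \<rho>(3) w_def power_mult_distrib)
  then have "0 = (LINT x|lborel. 2 * w x * (gv x \<bullet> e) - (w x)\<^sup>2)"
    using C1_supported_integral_zero(2)[OF S, of e] by simp
  also have "\<dots> \<le> (LINT x|lborel. 2 * (gv x \<bullet> e)\<^sup>2 - (1/2) * (w x)\<^sup>2)"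
  proof (rule integral_mono)
    show "integrable lborel (\<lambda>x. 2 * w x * (gv x \<bullet> e) - (w x)\<^sup>2)"
      by (rule Bochner_Integration.integrable_diff[OF iwg iw])
    show "integrable lborel (\<lambda>x. 2 * (gv x \<bullet> e)\<^sup>2 - (1/2) * (w x)\<^sup>2)"
      by (intro Bochner_Integration.integrable_diff integrable_mult_right iw ig)
    fix x
    have "0 \<le> (w x - 2 * (gv x \<bullet> e))\<^sup>2" by simp
    then show "2 * w x * (gv x \<bullet> e) - (w x)\<^sup>2 \<le> 2 * (gv x \<bullet> e)\<^sup>2 - (1/2) * (w x)\<^sup>2"
      by (simp add: power2_diff power_mult_distrib)
  qed
  also have "\<dots> = 2 * (LINT x|lborel. (gv x \<bullet> e)\<^sup>2) - (1/2) * (LINT x|lborel. (w x)\<^sup>2)"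
    by (simp only: Bochner_Integration.integral_diff[OF integrable_mult_right[OF ig] integrable_mult_right[OF iw]]
        integral_mult_right_zero)
  finally have "(LINT x|lborel. (w x)\<^sup>2) \<le> 4 * (LINT x|lborel. (gv x \<bullet> e)\<^sup>2)" by simp
  moreover have "w x = v x / \<rho> x" for x by (simp add: w_def divide_inverse)
  ultimately show "(LINT x|lborel. (v x / \<rho> x)\<^sup>2) \<le> 4 * (LINT x|lborel. (gv x \<bullet> e)\<^sup>2)"
    "integrable lborel (\<lambda>x. (v x / \<rho> x)\<^sup>2)" using iw by auto
qed

text \<open>\<open>P\<close> is the orthogonal projection onto the hyperplane normal to
  \<open>e\<close>. It is self-adjoint, so the chain rule gives the gradient
  \<open>P (g (P x))\<close> of the composition. This vector is orthogonal to \<open>e\<close>,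
  which is why the slope along \<open>e\<close> is exactly 1.\<close>

lemma GDERIV_epigraph:
  fixes \<gamma> :: "'a::euclidean_space \<Rightarrow> real"
  assumes e: "norm e = 1" and \<gamma>: "\<And>x. GDERIV \<gamma> x :> g x" "continuous_on UNIV g"
  defines "P \<equiv> \<lambda>x. x - (x \<bullet> e) *\<^sub>R e"
  shows "GDERIV (\<lambda>x. x \<bullet> e - \<gamma> (P x)) x :> e - P (g (P x))"
    "continuous_on UNIV (\<lambda>x. e - P (g (P x)))"
    "(e - P (g (P x))) \<bullet> e = 1"
proof -
  have ee: "e \<bullet> e = 1" using e by (simp add: norm_eq_1)
  have sa: "P h \<bullet> w = h \<bullet> P w" for h w
    by (simp add: P_def inner_simps inner_commute)
  have "(P has_derivative P) (at x)"
    unfolding P_def by (auto intro!: derivative_eq_intros)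
  from has_derivative_compose[OF this \<gamma>(1)[unfolded gderiv_def]]
  have "GDERIV (\<lambda>x. \<gamma> (P x)) x :> P (g (P x))"
    unfolding gderiv_def by (simp add: sa)
  then show "GDERIV (\<lambda>x. x \<bullet> e - \<gamma> (P x)) x :> e - P (g (P x))"
    by (intro GDERIV_diff GDERIV_inner_left)
  have Pc: "continuous_on UNIV P" unfolding P_def by (intro continuous_intros)
  have gP: "continuous_on UNIV (\<lambda>x. g (P x))"
    by (rule continuous_on_compose2[OF \<gamma>(2) Pc]) simp
  show "continuous_on UNIV (\<lambda>x. e - P (g (P x)))"
    by (intro continuous_intros continuous_on_compose2[OF Pc gP]) simp
  show "(e - P (g (P x))) \<bullet> e = 1"
    by (simp add: P_def inner_simps ee)
qed

text \<open>An explicit cut-off supported in the closed ball of radius \<open>|R|\<close>. Squaring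
  the positive part removes its corner, which gives exactly the C^1 regularity required by
  \<open>C1_supported\<close>.\<close>

lemma GDERIV_bump:
  fixes p :: "'a::euclidean_space"
  shows "GDERIV (\<lambda>x. (max 0 (R\<^sup>2 - (norm (x - p))\<^sup>2))\<^sup>2) x :> (- 4 * max 0 (R\<^sup>2 - (norm (x - p))\<^sup>2)) *\<^sub>R (x - p)"
    and "continuous_on UNIV (\<lambda>x. (- 4 * max 0 (R\<^sup>2 - (norm (x - p))\<^sup>2)) *\<^sub>R (x - p))"
proof -
  have m: "((\<lambda>t::real. (max 0 t)\<^sup>2) has_field_derivative 2 * max 0 t) (at t)" for t
  proof (cases "t = 0")
    case True
    have "((\<lambda>h::real. (max 0 h)\<^sup>2 / h) \<longlongrightarrow> 0) (at 0)"
    proof (rule Lim_null_comparison)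
      show "\<forall>\<^sub>F h in at 0. norm ((max 0 h)\<^sup>2 / h) \<le> \<bar>h::real\<bar>"
        by (rule always_eventually) (auto simp: max_def power2_eq_square)
      show "((\<lambda>h::real. \<bar>h\<bar>) \<longlongrightarrow> 0) (at 0)" by (auto intro!: tendsto_eq_intros)
    qed
    then show ?thesis using True by (simp add: DERIV_def)
  next
    case False
    then consider "t > 0" | "t < 0" by linarith
    then show ?thesis
    proof cases
      case 1
      have "((\<lambda>t::real. t\<^sup>2) has_field_derivative 2 * t) (at t)"
        by (auto intro!: derivative_eq_intros)
      then have "((\<lambda>t::real. (max 0 t)\<^sup>2) has_field_derivative 2 * t) (at t)"
        by (rule has_field_derivative_transform_within_open[where S="{0<..}"]) (use 1 in \<open>auto simp: max_def\<close>)
      then show ?thesis using 1 by simp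
    next
      case 2
      have "((\<lambda>t::real. (max 0 t)\<^sup>2) has_field_derivative 0) (at t)"
        by (rule has_field_derivative_transform_within_open[where S="{..<0}" and f="\<lambda>_. 0"])
          (use 2 in \<open>auto simp: max_def\<close>)
      then show ?thesis using 2 by simp
    qed
  qed
  have "((\<lambda>x. (x - p) \<bullet> (x - p)) has_derivative (\<lambda>h. h \<bullet> (2 *\<^sub>R (x - p)))) (at x)"
    by (auto intro!: derivative_eq_intros simp: inner_simps inner_commute)
  then have "GDERIV (\<lambda>x. R\<^sup>2 - (norm (x - p))\<^sup>2) x :> 0 - 2 *\<^sub>R (x - p)"
    unfolding power2_norm_eq_inner by (intro GDERIV_diff GDERIV_const) (simp add: gderiv_def)
  from GDERIV_DERIV_compose[OF this m]
  show "GDERIV (\<lambda>x. (max 0 (R\<^sup>2 - (norm (x - p))\<^sup>2))\<^sup>2) x :> (- 4 * max 0 (R\<^sup>2 - (norm (x - p))\<^sup>2)) *\<^sub>R (x - p)"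
    by (simp add: algebra_simps)
  show "continuous_on UNIV (\<lambda>x. (- 4 * max 0 (R\<^sup>2 - (norm (x - p))\<^sup>2)) *\<^sub>R (x - p))"
    by (intro continuous_intros)
qed

text \<open>The function \<open>u\<close> is cut off near \<open>p\<close> and
  \<open>hardy_along_direction\<close> is applied with the graph function \<open>\<rho>\<close>,
  which is at most a multiple of the distance. The cut-off region stays away from the origin, so
  there \<open>g\<close> and \<open>twisted_grad u g\<close> differ by at most a constant times
  \<open>|u|\<close>.\<close>

lemma boundary_hardy_local:
  fixes \<Omega> :: "'a::euclidean_space set"
  assumes N: "DIM('a) \<ge> 3" and O: "open \<Omega>" "C2_boundary \<Omega>" "0 \<in> \<Omega>" and p: "p \<in> frontier \<Omega>"
  obtains s A where "s > 0" "A \<ge> 0"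
    "\<And>K u g. C1_supported K u g \<Longrightarrow> K \<subseteq> \<Omega> \<Longrightarrow>
       (LINT x|lborel. indicator (ball p s) x * ((u x)\<^sup>2 / (bdist \<Omega> x)\<^sup>2))
         \<le> A * (hardy_deficit u g + (LINT x|lborel. (u x)\<^sup>2))"
proof -
  have dis: "\<Omega> \<inter> frontier \<Omega> = {}" by (rule open_Int_frontier_empty[OF O(1)])
  have fne: "frontier \<Omega> \<noteq> {}" using p by auto
  have p0: "p \<noteq> 0" using p dis O(3) by blast
  obtain r e \<gamma> where r: "r > 0" and e: "norm e = 1" and \<gamma>: "Ck 2 \<gamma>"
    and epi: "\<Omega> \<inter> ball p r = {x \<in> ball p r. x \<bullet> e > \<gamma> (x - (x \<bullet> e) *\<^sub>R e)}"
    using O(2) p unfolding C2_boundary_def by meson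
  have \<gamma>': "Ck (Suc 1) \<gamma>" using \<gamma> by (simp add: numeral_2_eq_2)
  define \<rho> where "\<rho> x = x \<bullet> e - \<gamma> (x - (x \<bullet> e) *\<^sub>R e)" for x
  define g\<rho> where "g\<rho> x = e - (grad \<gamma> (x - (x \<bullet> e) *\<^sub>R e) - (grad \<gamma> (x - (x \<bullet> e) *\<^sub>R e) \<bullet> e) *\<^sub>R e)" for x
  have \<rho>: "\<And>x. GDERIV \<rho> x :> g\<rho> x" "continuous_on UNIV g\<rho>" "\<And>x. g\<rho> x \<bullet> e = 1"
    unfolding \<rho>_def[abs_def] g\<rho>_def[abs_def] by (rule GDERIV_epigraph[OF e Ck_C1[OF \<gamma>']])+
  have epi': "x \<in> \<Omega> \<longleftrightarrow> \<rho> x > 0" if "x \<in> ball p r" for x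
    using epi that unfolding \<rho>_def by (auto simp del: mem_ball)
  \<comment> \<open>The bound \<open>r/2\<close> keeps a nearest boundary point of any
    \<open>x\<close> in \<open>ball p R\<close> inside the chart; the bound
    \<open>norm p / 2\<close> gives \<open>norm x \<ge> norm p / 2\<close> on
    \<open>cball p R\<close>.\<close>
  define R where "R = min (r/2) (norm p / 2)"
  have R: "R > 0" "2 * R \<le> r" "2 * R \<le> norm p" using r p0 by (auto simp: R_def)
  obtain L0 where L0: "\<And>x. x \<in> cball p r \<Longrightarrow> norm (g\<rho> x) \<le> L0"
    using compact_imp_bounded[OF compact_continuous_image[OF continuous_on_subset[OF \<rho>(2)], of "cball p r"]]
    unfolding bounded_iff by fastforce
  define L where "L = max 0 L0"
  have L: "L \<ge> 0" "L-lipschitz_on (ball p r) \<rho>"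
    using L0 \<rho>(1) unfolding L_def by (auto intro!: GDERIV_lipschitz simp: le_max_iff_disj)
  \<comment> \<open>A nearest boundary point \<open>y\<close> lies outside \<open>\<Omega>\<close>,
    so \<open>\<rho> y \<le> 0\<close> by the chart description, and the Lipschitz bound compares
    \<open>\<rho> x\<close> with \<open>\<rho> y\<close>.\<close>
  have \<rho>d: "\<rho> x \<le> L * bdist \<Omega> x" if "x \<in> ball p R" for x
  proof -
    obtain y where y: "y \<in> frontier \<Omega>" "bdist \<Omega> x = norm (x - y)"
      unfolding bdist_def using infdist_nearest_point[OF frontier_closed fne] by metis
    have "bdist \<Omega> x \<le> dist x p" unfolding bdist_def by (rule infdist_le[OF p])
    then have "dist x y < R" using that y(2) by (simp add: dist_norm norm_minus_commute)
    moreover have "dist p x < R" using that by simp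
    ultimately have "dist p y < r" using dist_triangle[of p y x] R by linarith
    then have yb: "y \<in> ball p r" by simp
    have xb: "x \<in> ball p r" using that R by auto
    have "y \<notin> \<Omega>" using y dis by blast
    then have "\<rho> y \<le> 0" using epi'[OF yb] by auto
    moreover have "\<bar>\<rho> x - \<rho> y\<bar> \<le> L * norm (x - y)"
      using lipschitz_onD[OF L(2) xb yb] by (simp add: dist_norm)
    ultimately show ?thesis unfolding y(2) by linarith
  qed
  define \<eta> where "\<eta> x = (max 0 (R\<^sup>2 - (norm (x - p))\<^sup>2))\<^sup>2" for x
  define g\<eta> where "g\<eta> x = (- 4 * max 0 (R\<^sup>2 - (norm (x - p))\<^sup>2)) *\<^sub>R (x - p)" for x
  have \<eta>: "\<And>x. GDERIV \<eta> x :> g\<eta> x" "continuous_on UNIV g\<eta>"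
    unfolding \<eta>_def[abs_def] g\<eta>_def[abs_def] by (rule GDERIV_bump)+
  define k where "k = (real DIM('a) - 2) / 2"
  have k: "k > 0" using N by (simp add: k_def)
  \<comment> \<open>A lower bound for \<open>\<eta>\<close> on the half ball, where
    \<open>R^2 - |x - p|^2\<close> is at least \<open>3/4 * R^2\<close>.\<close>
  define c where "c = (3/4 * R\<^sup>2)\<^sup>2"
  have c: "c > 0" using R by (simp add: c_def)
  \<comment> \<open>The two entries are the coefficients of \<open>norm (twisted_grad u g x)\<close>
    and of \<open>|u x|\<close> in the bound for \<open>gv\<close>: they use
    \<open>\<eta> \<le> R^4\<close>, \<open>norm (g\<eta> x) \<le> 4 * R^3\<close> and
    \<open>k / norm x \<le> 2 * k / norm p\<close>.\<close>
  define B0 where "B0 = max (R^4) (R^4 * (2 * k / norm p) + 4 * R^3)"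
  \<comment> \<open>The factors come from comparing \<open>u / d\<close> with
    \<open>v / \<rho>\<close>, from the Hardy constant 4, and from squaring a sum of two
    terms.\<close>
  define A where "A = (L\<^sup>2 / c\<^sup>2) * (4 * (2 * B0\<^sup>2))"
  show ?thesis
  proof (rule that)
    show "R / 2 > 0" using R by simp
    show "A \<ge> 0" unfolding A_def by simp
  next
    fix K and u :: "'a \<Rightarrow> real" and g
    assume u: "C1_supported K u g" and K: "K \<subseteq> \<Omega>"
    note d = C1_supportedD[OF u]
    define v where "v x = u x * \<eta> x" for x
    define gv where "gv x = u x *\<^sub>R g\<eta> x + \<eta> x *\<^sub>R g x" for x
    have \<eta>z: "\<eta> x = 0" if "x \<notin> cball p R" for x
    proof -
      have "R\<^sup>2 \<le> (norm (x - p))\<^sup>2" using that R by (intro power_mono) (auto simp: dist_norm norm_minus_commute)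
      then show ?thesis by (simp add: \<eta>_def)
    qed
    have v0: "C1_supported K v gv"
      unfolding v_def[abs_def] gv_def[abs_def] by (rule C1_supported_mult[OF u open_UNIV subset_UNIV \<eta>(2,1)])
    have v: "C1_supported (K \<inter> cball p R) v gv"
      using v0 \<eta>z unfolding C1_supported_def v_def by (auto intro: compact_Int)
    note dv = C1_supportedD[OF v]
    have "x \<in> K \<inter> cball p R \<Longrightarrow> \<rho> x > 0" for x
      using K epi'[of x] R by auto
    note H = hardy_along_direction[OF v \<rho> this]
    have ivd: "integrable lborel (\<lambda>x. (u x)\<^sup>2 / (bdist \<Omega> x)\<^sup>2)"
      by (rule integrable_div_bdist_squared[OF u K O(1) fne])
    have igv: "integrable lborel (\<lambda>x. (gv x \<bullet> e)\<^sup>2)"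
      using dv by (intro integrable_continuous_compact_support[of "K \<inter> cball p R"]) (auto intro!: continuous_intros)
    note hd = hardy_deficit_eq[OF u N]
    note iu = C1_supported_norm_grad_integrable(2)[OF u]
    have "(LINT x|lborel. (gv x \<bullet> e)\<^sup>2) \<le> (LINT x|lborel. 2 * B0\<^sup>2 * ((norm (twisted_grad u g x))\<^sup>2 + (u x)\<^sup>2))"
    proof (rule integral_mono[OF igv])
      show "integrable lborel (\<lambda>x. 2 * B0\<^sup>2 * ((norm (twisted_grad u g x))\<^sup>2 + (u x)\<^sup>2))"
        by (intro integrable_mult_right Bochner_Integration.integrable_add hd(1) iu)
      fix x
      have "\<bar>gv x \<bullet> e\<bar> \<le> norm (gv x)" using Cauchy_Schwarz_ineq2[of "gv x" e] e by simp
      also have "norm (gv x) \<le> B0 * (norm (twisted_grad u g x) + \<bar>u x\<bar>)"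
      proof (cases "x \<in> cball p R")
        case True
        then have xp: "norm (x - p) \<le> R" by (simp add: dist_norm norm_minus_commute)
        have "norm p \<le> norm x + norm (x - p)" by (metis norm_minus_commute norm_triangle_sub)
        then have xn: "norm p / 2 \<le> norm x" "norm x > 0" using R xp p0 by auto
        have m: "0 \<le> max 0 (R\<^sup>2 - (norm (x - p))\<^sup>2)" "max 0 (R\<^sup>2 - (norm (x - p))\<^sup>2) \<le> R\<^sup>2" by auto
        have \<eta>b: "0 \<le> \<eta> x" "\<eta> x \<le> R^4"
          using power_mono[OF m(2,1), of 2] unfolding \<eta>_def by (auto simp flip: power_mult)
        have "norm (g\<eta> x) = 4 * max 0 (R\<^sup>2 - (norm (x - p))\<^sup>2) * norm (x - p)"
          unfolding g\<eta>_def by simp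
        also have "\<dots> \<le> 4 * R\<^sup>2 * R" using m xp R by (intro mult_mono) auto
        finally have g\<eta>b: "norm (g\<eta> x) \<le> 4 * R^3" by (simp add: power2_eq_square power3_eq_cube)
        have "g x = twisted_grad u g x - (k * u x / (norm x)\<^sup>2) *\<^sub>R x"
          by (simp add: twisted_grad_def k_def)
        then have "norm (g x) \<le> norm (twisted_grad u g x) + norm ((k * u x / (norm x)\<^sup>2) *\<^sub>R x)"
          by (metis norm_triangle_ineq4)
        also have "norm ((k * u x / (norm x)\<^sup>2) *\<^sub>R x) = k / norm x * \<bar>u x\<bar>"
          using k xn by (simp add: abs_mult power2_eq_square)
        also have "k / norm x * \<bar>u x\<bar> \<le> (2 * k / norm p) * \<bar>u x\<bar>"
        proof -
          have "k / norm x \<le> k / (norm p / 2)" using xn k p0 by (intro divide_left_mono) auto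
          then show ?thesis by (intro mult_right_mono) (auto simp: mult.commute)
        qed
        finally have gb: "norm (g x) \<le> norm (twisted_grad u g x) + (2 * k / norm p) * \<bar>u x\<bar>" by simp
        have "norm (gv x) \<le> \<bar>u x\<bar> * norm (g\<eta> x) + \<eta> x * norm (g x)"
          unfolding gv_def using \<eta>b(1) norm_triangle_ineq[of "u x *\<^sub>R g\<eta> x" "\<eta> x *\<^sub>R g x"] by simp
        also have "\<dots> \<le> \<bar>u x\<bar> * (4 * R^3) + R^4 * (norm (twisted_grad u g x) + (2 * k / norm p) * \<bar>u x\<bar>)"
          using g\<eta>b gb \<eta>b R by (intro add_mono mult_mono) auto
        also have "\<dots> = R^4 * norm (twisted_grad u g x) + (R^4 * (2 * k / norm p) + 4 * R^3) * \<bar>u x\<bar>"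
          by (simp add: algebra_simps)
        also have "\<dots> \<le> B0 * norm (twisted_grad u g x) + B0 * \<bar>u x\<bar>"
          unfolding B0_def by (intro add_mono mult_right_mono) auto
        finally show ?thesis by (simp add: algebra_simps)
      next
        case False
        have "0 \<le> B0" unfolding B0_def by (simp add: le_max_iff_disj)
        then show ?thesis using dv(7)[of x] False by auto
      qed
      finally have "(gv x \<bullet> e)\<^sup>2 \<le> (B0 * (norm (twisted_grad u g x) + \<bar>u x\<bar>))\<^sup>2"
        by (metis abs_ge_zero power2_abs power_mono)
      also have "\<dots> \<le> 2 * B0\<^sup>2 * ((norm (twisted_grad u g x))\<^sup>2 + (u x)\<^sup>2)"
      proof -
        have "(norm (twisted_grad u g x) + \<bar>u x\<bar>)\<^sup>2 \<le> 2 * ((norm (twisted_grad u g x))\<^sup>2 + (u x)\<^sup>2)"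
          using sum_squares_bound[of "norm (twisted_grad u g x)" "\<bar>u x\<bar>"] by (simp add: power2_sum)
        then have "B0\<^sup>2 * (norm (twisted_grad u g x) + \<bar>u x\<bar>)\<^sup>2 \<le> B0\<^sup>2 * (2 * ((norm (twisted_grad u g x))\<^sup>2 + (u x)\<^sup>2))"
          by (intro mult_left_mono) auto
        then show ?thesis by (simp only: power_mult_distrib mult_ac)
      qed
      finally show "(gv x \<bullet> e)\<^sup>2 \<le> 2 * B0\<^sup>2 * ((norm (twisted_grad u g x))\<^sup>2 + (u x)\<^sup>2)" .
    qed
    also have "\<dots> = 2 * B0\<^sup>2 * (hardy_deficit u g + (LINT x|lborel. (u x)\<^sup>2))"
      by (simp only: integral_mult_right_zero Bochner_Integration.integral_add[OF hd(1) iu] hd(2))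
    finally have gvb: "(LINT x|lborel. (gv x \<bullet> e)\<^sup>2) \<le> 2 * B0\<^sup>2 * (hardy_deficit u g + (LINT x|lborel. (u x)\<^sup>2))" .
    have "(LINT x|lborel. indicator (ball p (R/2)) x * ((u x)\<^sup>2 / (bdist \<Omega> x)\<^sup>2))
       \<le> (LINT x|lborel. (L\<^sup>2 / c\<^sup>2) * (v x / \<rho> x)\<^sup>2)"
    proof (rule integral_mono)
      show "integrable lborel (\<lambda>x. indicator (ball p (R/2)) x * ((u x)\<^sup>2 / (bdist \<Omega> x)\<^sup>2))"
        using integrable_real_mult_indicator[OF _ ivd, of "ball p (R/2)"] by (simp add: mult.commute)
      show "integrable lborel (\<lambda>x. (L\<^sup>2 / c\<^sup>2) * (v x / \<rho> x)\<^sup>2)" by (intro integrable_mult_right H)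
      fix x
      show "indicator (ball p (R/2)) x * ((u x)\<^sup>2 / (bdist \<Omega> x)\<^sup>2) \<le> (L\<^sup>2 / c\<^sup>2) * (v x / \<rho> x)\<^sup>2"
      proof (cases "x \<in> ball p (R/2) \<and> x \<in> K")
        case True
        then have xb: "x \<in> ball p R" "x \<in> ball p r" "x \<in> \<Omega>" using R K by auto
        have \<rho>0: "\<rho> x > 0" using epi' xb by blast
        \<comment> \<open>Only \<open>L \<ge> 0\<close> is known in advance; a point of
          \<open>K\<close> in the ball forces both \<open>L\<close> and the distance to be
          positive.\<close>
        have "L * bdist \<Omega> x > 0" using \<rho>0 \<rho>d[OF xb(1)] by linarith
        then have d0: "bdist \<Omega> x > 0" using L(1) by (simp add: zero_less_mult_iff)
        have "(norm (x - p))\<^sup>2 \<le> (R/2)\<^sup>2"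
          using True by (intro power_mono) (auto simp: dist_norm norm_minus_commute)
        then have "3/4 * R\<^sup>2 \<le> max 0 (R\<^sup>2 - (norm (x - p))\<^sup>2)"
          by (simp add: power_divide le_max_iff_disj)
        then have "c \<le> \<eta> x" unfolding c_def \<eta>_def using R by (intro power_mono) auto
        then have "c * \<bar>u x\<bar> \<le> \<bar>v x\<bar>"
          using c unfolding v_def abs_mult by (subst mult.commute[of "\<bar>u x\<bar>"]) (intro mult_right_mono, auto)
        then have "\<bar>u x\<bar> / bdist \<Omega> x \<le> (\<bar>v x\<bar> / c) / (\<rho> x / L)"
        proof -
          have Lp: "L > 0" using \<open>L * bdist \<Omega> x > 0\<close> d0 by (simp add: zero_less_mult_iff)
          have "\<bar>u x\<bar> \<le> \<bar>v x\<bar> / c" using \<open>c * \<bar>u x\<bar> \<le> \<bar>v x\<bar>\<close> c by (simp add: field_simps)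
          moreover have "\<rho> x / L \<le> bdist \<Omega> x" using \<rho>d[OF xb(1)] Lp by (simp add: field_simps)
          ultimately show ?thesis using \<rho>0 Lp c by (intro frac_le) auto
        qed
        then have "(\<bar>u x\<bar> / bdist \<Omega> x)\<^sup>2 \<le> ((\<bar>v x\<bar> / c) / (\<rho> x / L))\<^sup>2"
          using d0 by (intro power_mono) auto
        then show ?thesis using True by (simp add: power_divide power_mult_distrib mult_ac)
      next
        case False
        then have "indicator (ball p (R/2)) x * ((u x)\<^sup>2 / (bdist \<Omega> x)\<^sup>2) = 0"
          using d(5) by (auto simp: indicator_def)
        then show ?thesis by (simp only:) simp
      qed
    qed
    also have "\<dots> \<le> (L\<^sup>2 / c\<^sup>2) * (4 * (LINT x|lborel. (gv x \<bullet> e)\<^sup>2))"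
      unfolding integral_mult_right_zero by (intro mult_left_mono H divide_nonneg_nonneg zero_le_power2)
    also have "\<dots> \<le> (L\<^sup>2 / c\<^sup>2) * (4 * (2 * B0\<^sup>2 * (hardy_deficit u g + (LINT x|lborel. (u x)\<^sup>2))))"
      by (intro mult_left_mono gvb divide_nonneg_nonneg zero_le_power2) simp
    finally show "(LINT x|lborel. indicator (ball p (R/2)) x * ((u x)\<^sup>2 / (bdist \<Omega> x)\<^sup>2))
         \<le> A * (hardy_deficit u g + (LINT x|lborel. (u x)\<^sup>2))"
      unfolding A_def by (simp only: mult.assoc)
  qed
qed

subsection \<open>Global inequalities\<close>

text \<open>Finitely many of the local balls cover the compact boundary. What remains of the domain
  has distance at least some \<open>\<delta> > 0\<close>, so there \<open>u^2 / d^2\<close> is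
  controlled by \<open>u^2\<close>, and \<open>hardy_deficit_ge_L2\<close> turns all terms in
  \<open>u^2\<close> into the deficit.\<close>

lemma boundary_hardy:
  fixes \<Omega> :: "'a::euclidean_space set"
  assumes N: "DIM('a) \<ge> 3" and \<Omega>: "smooth_bounded_domain \<Omega>" "0 \<in> \<Omega>"
  obtains A where "A \<ge> 0"
    "\<And>K u g. C1_supported K u g \<Longrightarrow> K \<subseteq> \<Omega> \<Longrightarrow>
       (LINT x|lborel. (u x)\<^sup>2 / (bdist \<Omega> x)\<^sup>2) \<le> A * hardy_deficit u g"
proof -
  have O: "open \<Omega>" "C2_boundary \<Omega>" "bounded \<Omega>"
    using \<Omega>(1) by (auto simp: smooth_bounded_domain_def)
  have fne: "frontier \<Omega> \<noteq> {}"
    using O(3) \<Omega>(2) not_bounded_UNIV by (auto simp: frontier_eq_empty)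
  have fc: "compact (frontier \<Omega>)" using O(3) by (simp add: compact_frontier_bounded)
  obtain M where M: "M > 0" "\<Omega> \<subseteq> cball 0 M"
    using O(3) by (auto simp: bounded_pos subset_iff)
  let ?P = "\<lambda>p s A. s > 0 \<and> A \<ge> 0 \<and> (\<forall>K u g. C1_supported K u g \<longrightarrow> K \<subseteq> \<Omega> \<longrightarrow>
       (LINT x|lborel. indicator (ball p s) x * ((u x)\<^sup>2 / (bdist \<Omega> x)\<^sup>2))
         \<le> A * (hardy_deficit u g + (LINT x|lborel. (u x)\<^sup>2)))"
  \<comment> \<open>The radius and the constant are chosen before \<open>u\<close>, so the finite
    cover and the final constant are uniform in \<open>u\<close>.\<close>
  have "\<forall>p\<in>frontier \<Omega>. \<exists>s A. ?P p s A"
  proof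
    fix p assume p: "p \<in> frontier \<Omega>"
    show "\<exists>s A. ?P p s A"
    proof (rule boundary_hardy_local[OF N O(1,2) \<Omega>(2) p])
      fix s A
      assume "s > 0" "A \<ge> 0" "\<And>K u g. C1_supported K u g \<Longrightarrow> K \<subseteq> \<Omega> \<Longrightarrow>
       (LINT x|lborel. indicator (ball p s) x * ((u x)\<^sup>2 / (bdist \<Omega> x)\<^sup>2))
         \<le> A * (hardy_deficit u g + (LINT x|lborel. (u x)\<^sup>2))"
      then show ?thesis by (intro exI[of _ s] exI[of _ A] conjI allI impI)
    qed
  qed
  from bchoice[OF this] obtain s where "\<forall>p\<in>frontier \<Omega>. \<exists>A. ?P p (s p) A" by (rule exE)
  from bchoice[OF this] obtain A where "\<forall>p\<in>frontier \<Omega>. ?P p (s p) (A p)" by (rule exE)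
  then have sA: "?P p (s p) (A p)" if "p \<in> frontier \<Omega>" for p using that by (rule bspec)
  have s0: "s p > 0" if "p \<in> frontier \<Omega>" for p using sA[OF that] by (rule conjunct1)
  have sub: "frontier \<Omega> \<subseteq> (\<Union>p\<in>frontier \<Omega>. ball p (s p))"
    using s0 by force
  obtain T where T: "T \<subseteq> frontier \<Omega>" "finite T" "frontier \<Omega> \<subseteq> (\<Union>p\<in>T. ball p (s p))"
    by (rule compactE_image[OF fc _ sub]) auto
  define V where "V = (\<Union>p\<in>T. ball p (s p))"
  have kc: "compact (closure \<Omega> - V)"
    using O(3) by (intro compact_diff) (auto simp: V_def)
  have kd: "(closure \<Omega> - V) \<inter> frontier \<Omega> = {}" using T(3) unfolding V_def by auto
  obtain \<delta> where \<delta>: "\<delta> > 0" "\<And>x. x \<in> closure \<Omega> - V \<Longrightarrow> \<delta> \<le> bdist \<Omega> x"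
    using compact_bdist_lower_bound[OF kc kd fne] by blast
  \<comment> \<open>Each ball costs \<open>A p\<close> times the deficit plus the L^2 term, and that
    term is at most \<open>M^2\<close> times the deficit; \<open>M^2 / \<delta>^2\<close> pays for
    the interior.\<close>
  define B where "B = (\<Sum>p\<in>T. A p) * (1 + M\<^sup>2) + M\<^sup>2 / \<delta>\<^sup>2"
  have A0: "0 \<le> A p" if "p \<in> T" for p
    using sA[OF subsetD[OF T(1) that]] by (rule conjunct1[OF conjunct2])
  show ?thesis
  proof (rule that)
    show "0 \<le> B" unfolding B_def using A0 by (intro add_nonneg_nonneg mult_nonneg_nonneg sum_nonneg) auto
  next
    fix K and u :: "'a \<Rightarrow> real" and g
    assume u: "C1_supported K u g" and K: "K \<subseteq> \<Omega>"
    note d = C1_supportedD[OF u]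
    let ?f = "\<lambda>x. (u x)\<^sup>2 / (bdist \<Omega> x)\<^sup>2"
    let ?Q = "hardy_deficit u g"
    let ?I = "LINT x|lborel. (u x)\<^sup>2"
    have i: "integrable lborel ?f"
      by (rule integrable_div_bdist_squared[OF u K O(1) fne])
    have iB: "integrable lborel (\<lambda>x. indicator (ball p (s p)) x * ?f x)" for p
      using integrable_real_mult_indicator[OF _ i, of "ball p (s p)"] by (simp add: mult.commute)
    note iu = C1_supported_norm_grad_integrable(2)[OF u]
    have L2: "?I \<le> M\<^sup>2 * ?Q" using hardy_deficit_ge_L2[OF u N M(1)] M(2) K by auto
    have "integral\<^sup>L lborel ?f \<le> (LINT x|lborel. (\<Sum>p\<in>T. indicator (ball p (s p)) x * ?f x) + (1 / \<delta>\<^sup>2) * (u x)\<^sup>2)"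
    proof (rule integral_mono[OF i])
      show "integrable lborel (\<lambda>x. (\<Sum>p\<in>T. indicator (ball p (s p)) x * ?f x) + (1 / \<delta>\<^sup>2) * (u x)\<^sup>2)"
        by (intro Bochner_Integration.integrable_add Bochner_Integration.integrable_sum integrable_mult_right iB iu)
      fix x
      have nn: "0 \<le> (\<Sum>p\<in>T. indicator (ball p (s p)) x * ?f x)" by (intro sum_nonneg) auto
      have n1: "0 \<le> (1 / \<delta>\<^sup>2) * (u x)\<^sup>2" by simp
      show "?f x \<le> (\<Sum>p\<in>T. indicator (ball p (s p)) x * ?f x) + (1 / \<delta>\<^sup>2) * (u x)\<^sup>2"
      proof (cases "x \<in> V")
        case True
        then obtain p where p: "p \<in> T" "x \<in> ball p (s p)" by (auto simp: V_def)
        have "?f x = indicator (ball p (s p)) x * ?f x" using p by simp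
        also have "\<dots> \<le> (\<Sum>p\<in>T. indicator (ball p (s p)) x * ?f x)"
          using p T(2) by (intro member_le_sum) auto
        finally show ?thesis using n1 by linarith
      next
        case False
        have "?f x \<le> (1 / \<delta>\<^sup>2) * (u x)\<^sup>2"
        proof (cases "x \<in> K")
          case True
          then have "\<delta> \<le> bdist \<Omega> x" using \<delta>(2) False K closure_subset by blast
          then have "\<delta>\<^sup>2 \<le> (bdist \<Omega> x)\<^sup>2" using \<delta>(1) by (intro power_mono) auto
          then have "(u x)\<^sup>2 / (bdist \<Omega> x)\<^sup>2 \<le> (u x)\<^sup>2 / \<delta>\<^sup>2" using \<delta>(1) by (intro frac_le) auto
          then show ?thesis by simp
        qed (use d(5) in auto)
        then show ?thesis using nn by linarith
      qed
    qed
    also have "\<dots> = (\<Sum>p\<in>T. LINT x|lborel. indicator (ball p (s p)) x * ?f x) + (1 / \<delta>\<^sup>2) * ?I"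
      by (simp only: Bochner_Integration.integral_add Bochner_Integration.integral_sum
          Bochner_Integration.integrable_sum iB iu integrable_mult_right integral_mult_right_zero)
    also have "\<dots> \<le> (\<Sum>p\<in>T. A p * (?Q + M\<^sup>2 * ?Q)) + (1 / \<delta>\<^sup>2) * (M\<^sup>2 * ?Q)"
    proof (intro add_mono sum_mono mult_left_mono L2)
      fix p assume p: "p \<in> T"
      have "(LINT x|lborel. indicator (ball p (s p)) x * ?f x) \<le> A p * (?Q + ?I)"
        using sA[OF subsetD[OF T(1) p], THEN conjunct2, THEN conjunct2] u K by (simp only:)
      also have "\<dots> \<le> A p * (?Q + M\<^sup>2 * ?Q)"
        using L2 A0[OF p] by (intro mult_left_mono) auto
      finally show "(LINT x|lborel. indicator (ball p (s p)) x * ?f x) \<le> A p * (?Q + M\<^sup>2 * ?Q)" .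
    qed simp
    also have "\<dots> = B * ?Q"
      unfolding B_def sum_distrib_right[symmetric] by (simp add: algebra_simps)
    finally show "integral\<^sup>L lborel ?f \<le> B * ?Q" .
  qed
qed

section \<open>The constant 1/4 under the divergence condition\<close>

text \<open>This makes \<open>u^2 / d\<close> admissible in \<open>weak_laplacian_le\<close>,
  although \<open>d\<close> vanishes on the boundary. Changing the numerator and the denominator
  separately needs a lower bound for \<open>f\<close> at one point of \<open>K\<close> only: if the
  other point lies off \<open>K\<close>, the second change is multiplied by
  \<open>u y = 0\<close>.\<close>

lemma lipschitz_square_over:
  fixes u f :: "'a::euclidean_space \<Rightarrow> real"
  assumes L: "L-lipschitz_on UNIV (\<lambda>x. (u x)\<^sup>2)" and M: "M-lipschitz_on UNIV f"
    and K: "\<And>x. x \<notin> K \<Longrightarrow> u x = 0" and B: "\<And>x. \<bar>u x\<bar> \<le> B"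
    and \<delta>: "\<delta> > 0" "\<And>x. x \<in> K \<Longrightarrow> \<delta> \<le> f x"
  shows "(L / \<delta> + B\<^sup>2 * M / \<delta>\<^sup>2)-lipschitz_on UNIV (\<lambda>x. (u x)\<^sup>2 / f x)"
proof (rule lipschitz_onI)
  let ?C = "L / \<delta> + B\<^sup>2 * M / \<delta>\<^sup>2"
  have LM: "L \<ge> 0" "M \<ge> 0" using L M by (auto intro: lipschitz_on_nonneg)
  then show C: "0 \<le> ?C" using \<delta>(1) by simp
  have main: "\<bar>(u x)\<^sup>2 / f x - (u y)\<^sup>2 / f y\<bar> \<le> ?C * dist x y" if x: "x \<in> K" for x y
  proof -
    have fx: "\<delta> \<le> f x" "f x > 0" using \<delta>(1) \<delta>(2)[OF x] by auto
    have 1: "\<bar>((u x)\<^sup>2 - (u y)\<^sup>2) / f x\<bar> \<le> L / \<delta> * dist x y"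
    proof -
      have "\<bar>(u x)\<^sup>2 - (u y)\<^sup>2\<bar> \<le> L * dist x y"
        using lipschitz_onD[OF L, of x y] by (simp add: dist_real_def)
      then have "\<bar>(u x)\<^sup>2 - (u y)\<^sup>2\<bar> / f x \<le> (L * dist x y) / \<delta>"
        using fx \<delta>(1) by (intro frac_le) auto
      then show ?thesis using fx by (simp add: abs_divide)
    qed
    have 2: "\<bar>(u y)\<^sup>2 / f x - (u y)\<^sup>2 / f y\<bar> \<le> B\<^sup>2 * M / \<delta>\<^sup>2 * dist x y"
    proof (cases "y \<in> K")
      case True
      then have fy: "\<delta> \<le> f y" "f y > 0" using \<delta>(1) \<delta>(2) by force+
      have "(u y)\<^sup>2 / f x - (u y)\<^sup>2 / f y = (u y)\<^sup>2 * (f y - f x) / (f x * f y)"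
        using fx fy by (simp add: field_simps)
      then have "\<bar>(u y)\<^sup>2 / f x - (u y)\<^sup>2 / f y\<bar> = (u y)\<^sup>2 * \<bar>f y - f x\<bar> / (f x * f y)"
        using fx fy by (simp add: abs_mult)
      also have "\<dots> \<le> B\<^sup>2 * (M * dist x y) / (\<delta> * \<delta>)"
      proof (intro frac_le mult_mono)
        show "\<bar>f y - f x\<bar> \<le> M * dist x y"
          using lipschitz_onD[OF M, of y x] by (simp add: dist_real_def dist_commute)
        show "(u y)\<^sup>2 \<le> B\<^sup>2" using power_mono[OF B[of y], of 2] by simp
      qed (use fx fy \<delta>(1) LM in auto)
      finally show ?thesis by (simp add: power2_eq_square)
    qed (use K LM \<delta>(1) in auto)
    have "(u x)\<^sup>2 / f x - (u y)\<^sup>2 / f y = ((u x)\<^sup>2 - (u y)\<^sup>2) / f x + ((u y)\<^sup>2 / f x - (u y)\<^sup>2 / f y)"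
      by (simp add: diff_divide_distrib)
    then have "\<bar>(u x)\<^sup>2 / f x - (u y)\<^sup>2 / f y\<bar> \<le> L / \<delta> * dist x y + B\<^sup>2 * M / \<delta>\<^sup>2 * dist x y"
      using 1 2 by linarith
    then show ?thesis by (simp add: distrib_right)
  qed
  fix x y
  show "dist ((u x)\<^sup>2 / f x) ((u y)\<^sup>2 / f y) \<le> ?C * dist x y"
  proof (cases "x \<in> K")
    case True
    then show ?thesis using main[of x y] by (simp add: dist_real_def)
  next
    case False
    note xK = this
    show ?thesis
    proof (cases "y \<in> K")
      case True
      then show ?thesis using main[of y x] by (simp add: dist_real_def dist_commute abs_minus_commute)
    next
      case False
      then show ?thesis using K[OF xK] K[OF False] C by simp
    qed
  qed
qed

text \<open>With \<open>a = 2 - N\<close>, the product rule gives \<open>div (|x|^a \<nabla>d) =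
  |x|^a (\<Delta>d + a (x \<bullet> \<nabla>d) / |x|^2)\<close>. Dividing by the positive weight
  turns the hypothesis into an upper bound for the pointwise Laplacian, which is the limit of the
  second quotients.\<close>

lemma weighted_divergence_bound:
  fixes \<Omega> :: "'a::euclidean_space set"
  assumes x: "x \<noteq> 0"
    and ev: "\<forall>\<^sub>F y in nhds x. bdist \<Omega> differentiable (at y)"
    and W: "weighted_grad_bdist \<Omega> differentiable (at x)"
    and div: "- divergence (weighted_grad_bdist \<Omega>) x \<ge> 0"
  shows "\<exists>l \<le> (real DIM('a) - 2) * (x \<bullet> grad (bdist \<Omega>) x) / (norm x)\<^sup>2.
     (\<lambda>n. \<Sum>b\<in>Basis. dquot2 (bdist \<Omega>) b n x) \<longlonglongrightarrow> l"
proof -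
  define a where "a = 2 - real DIM('a)"
  let ?G = "grad (bdist \<Omega>)"
  let ?W = "weighted_grad_bdist \<Omega>"
  have Weq: "?W y = (norm y powr a) *\<^sub>R ?G y" for y by (simp add: weighted_grad_bdist_def a_def)
  have evG: "\<forall>\<^sub>F y in nhds x. GDERIV (bdist \<Omega>) y :> ?G y"
    using ev by eventually_elim (rule differentiable_imp_GDERIV)
  have hn: "(norm has_derivative (\<lambda>h. h \<bullet> sgn x)) (at x)"
    using GDERIV_norm[OF x] by (simp add: gderiv_def)
  have pw: "((\<lambda>y. norm y powr c) has_derivative (\<lambda>h. c * norm x powr (c - 1) * (h \<bullet> sgn x))) (at x)" for c
  proof -
    have "((\<lambda>t. t powr c) has_field_derivative c * norm x powr (c - 1)) (at (norm x))"
      using x by (intro has_real_derivative_powr) auto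
    from has_derivative_compose[OF hn this[unfolded has_field_derivative_def]]
    show ?thesis by simp
  qed
  \<comment> \<open>Away from the origin the weight can be divided out smoothly, so
    differentiability of the weighted field passes to the gradient of the distance.\<close>
  have Geq: "?G y = (norm y powr (-a)) *\<^sub>R ?W y" if "y \<noteq> 0" for y
    using that by (simp add: Weq powr_add[symmetric])
  obtain W' where "(?W has_derivative W') (at x)" using W unfolding differentiable_def by blast
  from has_derivative_scaleR[OF pw[of "-a"] this]
  obtain D where D': "((\<lambda>y. (norm y powr (-a)) *\<^sub>R ?W y) has_derivative D) (at x)" by blast
  have D: "(?G has_derivative D) (at x)"
    by (rule has_derivative_transform_within_open[OF D', where s="- {0}"]) (use x Geq in auto)
  have "(?W has_derivative (\<lambda>h. (norm x powr a) *\<^sub>R D h + (a * norm x powr (a - 1) * (h \<bullet> sgn x)) *\<^sub>R ?G x)) (at x)"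
    unfolding Weq[abs_def] by (rule has_derivative_scaleR[OF pw D])
  then have fd: "frechet_derivative ?W (at x) = (\<lambda>h. (norm x powr a) *\<^sub>R D h + (a * norm x powr (a - 1) * (h \<bullet> sgn x)) *\<^sub>R ?G x)"
    by (rule frechet_derivative_at[symmetric])
  have sg: "sgn x = (1 / norm x) *\<^sub>R x" by (simp add: sgn_div_norm divide_inverse)
  have "divergence ?W x = (\<Sum>b\<in>Basis. norm x powr a * (D b \<bullet> b) + a * norm x powr (a - 1) / norm x * ((x \<bullet> b) * (?G x \<bullet> b)))"
    unfolding divergence_def fd by (rule sum.cong) (auto simp: inner_simps sg inner_commute)
  also have "\<dots> = norm x powr a * (\<Sum>b\<in>Basis. D b \<bullet> b) + a * norm x powr (a - 1) / norm x * (x \<bullet> ?G x)"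
    unfolding sum.distrib sum_distrib_left[symmetric] euclidean_inner[of x "?G x"] by simp
  also have "norm x powr (a - 1) = norm x powr a / norm x"
    using x by (simp add: powr_diff)
  finally have "norm x powr a * ((\<Sum>b\<in>Basis. D b \<bullet> b) + a * (x \<bullet> ?G x) / (norm x)\<^sup>2) \<le> 0"
    using div by (simp add: algebra_simps power2_eq_square)
  then have "(\<Sum>b\<in>Basis. D b \<bullet> b) + a * (x \<bullet> ?G x) / (norm x)\<^sup>2 \<le> 0"
    using x by (simp add: mult_le_0_iff)
  then have "(\<Sum>b\<in>Basis. D b \<bullet> b) \<le> (real DIM('a) - 2) * (x \<bullet> ?G x) / (norm x)\<^sup>2"
    by (simp add: a_def diff_divide_distrib left_diff_distrib)
  moreover have "(\<lambda>n. \<Sum>b\<in>Basis. dquot2 (bdist \<Omega>) b n x) \<longlonglongrightarrow> (\<Sum>b\<in>Basis. D b \<bullet> b)"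
    by (intro tendsto_sum dquot2_tendsto[OF evG D])
  ultimately show ?thesis by blast
qed

text \<open>The square \<open>|G - (u / (2 d)) \<nabla>d|^2\<close> is rewritten through the
  gradient of \<open>p = u^2 / d\<close>, so that derivatives of \<open>d\<close> of order two enter
  only through \<open>weak_laplacian_le\<close>, with \<open>p\<close> as the nonnegative test
  function.\<close>

lemma boundary_hardy_sharp:
  fixes \<Omega> :: "'a::euclidean_space set"
  assumes N: "DIM('a) \<ge> 3" and O: "open \<Omega>" "frontier \<Omega> \<noteq> {}" and dc: "div_condition \<Omega>"
    and u: "C1_supported K u g" and K: "K \<subseteq> \<Omega>"
  shows "1/4 * (LINT x|lborel. (u x)\<^sup>2 / (bdist \<Omega> x)\<^sup>2) \<le> hardy_deficit u g"
proof -
  note du = C1_supportedD[OF u]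
  define d where "d = bdist \<Omega>"
  define k where "k = (real DIM('a) - 2) / 2"
  have k: "k > 0" using N by (simp add: k_def)
  have k2: "real DIM('a) - 2 = 2 * k" by (simp add: k_def)
  have "K \<inter> frontier \<Omega> = {}" using open_Int_frontier_empty[OF O(1)] K by blast
  from compact_bdist_lower_bound[OF du(1) this O(2)]
  obtain \<delta> where \<delta>: "\<delta> > 0" "\<And>x. x \<in> K \<Longrightarrow> \<delta> \<le> d x"
    unfolding d_def by blast
  obtain B where B: "\<And>x. \<bar>u x\<bar> \<le> B" using C1_supported_bounded[OF u] by metis
  obtain L where L: "L-lipschitz_on UNIV (\<lambda>x. (u x)\<^sup>2)"
    by (rule C1_supported_lipschitz[OF C1_supported_square[OF u]])
  have dl: "1-lipschitz_on UNIV d" unfolding d_def bdist_def[abs_def] by (rule infdist_lipschitz)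
  \<comment> \<open>Defined at every point as a limit of quotients, with an arbitrary value where
    they diverge, so that it is Borel measurable; it equals the gradient wherever \<open>d\<close>
    is differentiable.\<close>
  define gd where "gd x = (\<Sum>b\<in>Basis. lim (\<lambda>n. dquot d b n x) *\<^sub>R b)" for x
  define p where "p x = (u x)\<^sup>2 / d x" for x
  define gp where "gp x = (2 * u x / d x) *\<^sub>R g x - ((u x)\<^sup>2 / (d x)\<^sup>2) *\<^sub>R gd x" for x
  \<comment> \<open>The upper bound for the Laplacian of \<open>d\<close> that
    \<open>weighted_divergence_bound\<close> extracts from the divergence condition, since
    \<open>N - 2 = 2 k\<close>.\<close>
  define \<phi> where "\<phi> x = 2 * k * (x \<bullet> gd x) / (norm x)\<^sup>2" for x
  have um: "u \<in> borel_measurable lborel" and gm: "g \<in> borel_measurable lborel"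
    using du by (auto simp: borel_measurable_continuous_onI)
  have dm: "d \<in> borel_measurable lborel" unfolding d_def by (rule bdist_measurable)
  have gdm: "gd \<in> borel_measurable lborel"
    unfolding gd_def using dquot_measurable[OF lipschitz_on_continuous_on[OF dl]]
    by (intro borel_measurable_sum borel_measurable_scaleR borel_measurable_lim_metric) auto
  have gd: "gd x = D" if "GDERIV d x :> D" for x D
    unfolding gd_def using limI[OF dquot_tendsto[OF that]] by (simp add: euclidean_representation)
  have pl: "(L / \<delta> + B\<^sup>2 * 1 / \<delta>\<^sup>2)-lipschitz_on UNIV p"
    unfolding p_def[abs_def] by (rule lipschitz_square_over[OF L dl du(5) B \<delta>])
  have p0: "p x = 0" if "x \<notin> K" for x using du(5) that by (simp add: p_def)
  have gp0: "gp x = 0" if "x \<notin> K" for x using du(5,7) that by (simp add: gp_def)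
  have dnn: "0 \<le> d x" for x unfolding d_def bdist_def by (rule infdist_nonneg)
  have ae: "AE x in lborel. x \<in> K \<longrightarrow> GDERIV d x :> gd x \<and>
      (\<exists>l \<le> \<phi> x. (\<lambda>n. \<Sum>b\<in>Basis. dquot2 d b n x) \<longlonglongrightarrow> l)"
    using dc[unfolded div_condition_def] AE_lborel_nonzero
  proof eventually_elim
    case (elim x)
    show ?case
    proof
      assume "x \<in> K"
      then have e: "\<forall>\<^sub>F y in nhds x. d differentiable (at y)" "weighted_grad_bdist \<Omega> differentiable (at x)"
        "- divergence (weighted_grad_bdist \<Omega>) x \<ge> 0"
        using elim(1) K by (auto simp: d_def)
      have G: "GDERIV d x :> grad d x"
        using eventually_nhds_x_imp_x[OF e(1)] by (rule differentiable_imp_GDERIV)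
      then have eq: "gd x = grad d x" by (rule gd)
      have "(real DIM('a) - 2) * (x \<bullet> grad d x) / (norm x)\<^sup>2 = \<phi> x"
        unfolding \<phi>_def eq by (simp add: k2)
      then show "GDERIV d x :> gd x \<and> (\<exists>l \<le> \<phi> x. (\<lambda>n. \<Sum>b\<in>Basis. dquot2 d b n x) \<longlonglongrightarrow> l)"
        using weighted_divergence_bound[OF elim(2) e(1)[unfolded d_def] e(2,3), folded d_def] G eq by simp
    qed
  qed
  have aeG: "AE x in lborel. x \<in> K \<longrightarrow> GDERIV d x :> gd x" using ae by eventually_elim blast
  have aep: "AE x in lborel. GDERIV p x :> gp x"
    using aeG
  proof eventually_elim
    case (elim x)
    show ?case
    proof (cases "x \<in> K")
      case True
      then have dx: "d x \<noteq> 0" using \<delta>(1) \<delta>(2)[OF True] by linarith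
      have "GDERIV (\<lambda>x. (u x)\<^sup>2 * inverse (d x)) x :>
         (u x)\<^sup>2 *\<^sub>R (- (inverse (d x))\<^sup>2 *\<^sub>R gd x) + inverse (d x) *\<^sub>R ((2 * u x) *\<^sub>R g x)"
        using elim True dx C1_supportedD(4)[OF C1_supported_square[OF u]]
        by (intro GDERIV_mult GDERIV_inverse) auto
      then show ?thesis
        unfolding p_def[abs_def] gp_def by (simp add: divide_inverse mult_ac power_inverse)
    next
      case False
      then show ?thesis unfolding gp0[OF False] using p0 by (intro GDERIV_zero_outside[OF du(2)])
    qed
  qed
  note hd = hardy_deficit_eq[OF u N]
  note hi = hardy_integrable[OF u N]
  note iu = C1_supported_norm_grad_integrable(2)[OF u]
  \<comment> \<open>Near the origin \<open>\<phi>\<close> is of order at most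
    \<open>1 / |x|\<close>; bounding this by \<open>1 + 1 / |x|^2\<close> brings it under
    \<open>hardy_integrable\<close>, while \<open>1 / d \<le> 1 / \<delta>\<close> on
    \<open>K\<close>.\<close>
  have iphi: "integrable lborel (\<lambda>x. \<phi> x * p x)"
  proof (rule Bochner_Integration.integrable_bound)
    show "integrable lborel (\<lambda>x. (2 * k / \<delta>) * ((u x)\<^sup>2 + (u x)\<^sup>2 / (norm x)\<^sup>2))"
      by (intro integrable_mult_right Bochner_Integration.integrable_add iu hi)
    show "(\<lambda>x. \<phi> x * p x) \<in> borel_measurable lborel"
      unfolding \<phi>_def p_def using um dm gdm by simp
    show "AE x in lborel. norm (\<phi> x * p x) \<le> norm ((2 * k / \<delta>) * ((u x)\<^sup>2 + (u x)\<^sup>2 / (norm x)\<^sup>2))"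
      using aeG AE_lborel_nonzero
    proof eventually_elim
      case (elim x)
      show ?case
      proof (cases "x \<in> K")
        case True
        have n1: "norm (gd x) \<le> 1" by (rule norm_GDERIV_le_lipschitz[OF dl]) (use elim True in auto)
        have "\<bar>x \<bullet> gd x\<bar> \<le> norm x * norm (gd x)" by (rule Cauchy_Schwarz_ineq2)
        also have "\<dots> \<le> norm x * 1" by (intro mult_left_mono n1) auto
        finally have c: "\<bar>x \<bullet> gd x\<bar> \<le> norm x" by simp
        have "norm x \<le> (norm x)\<^sup>2 + 1"
          using sum_squares_bound[of "norm x" 1, simplified] norm_ge_zero[of x] by linarith
        then have "\<bar>x \<bullet> gd x\<bar> / (norm x)\<^sup>2 \<le> ((norm x)\<^sup>2 + 1) / (norm x)\<^sup>2"
          using c by (intro divide_right_mono) auto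
        also have "\<dots> = 1 + 1 / (norm x)\<^sup>2" using elim by (simp add: field_simps)
        finally have "2 * k * (\<bar>x \<bullet> gd x\<bar> / (norm x)\<^sup>2) \<le> 2 * k * (1 + 1 / (norm x)\<^sup>2)"
          using k by (intro mult_left_mono) auto
        moreover have "\<bar>\<phi> x\<bar> = 2 * k * (\<bar>x \<bullet> gd x\<bar> / (norm x)\<^sup>2)"
          using k unfolding \<phi>_def by (simp add: abs_mult)
        ultimately have 1: "\<bar>\<phi> x\<bar> \<le> 2 * k * (1 + 1 / (norm x)\<^sup>2)" by simp
        have 2: "\<bar>p x\<bar> \<le> (u x)\<^sup>2 / \<delta>"
          unfolding p_def using \<delta>(1) \<delta>(2)[OF True] by (simp add: frac_le)
        have "norm (\<phi> x * p x) \<le> (2 * k * (1 + 1 / (norm x)\<^sup>2)) * ((u x)\<^sup>2 / \<delta>)"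
          using 1 2 k unfolding real_norm_def abs_mult by (intro mult_mono) auto
        also have "\<dots> = (2 * k / \<delta>) * ((u x)\<^sup>2 + (u x)\<^sup>2 / (norm x)\<^sup>2)" by (simp add: algebra_simps)
        also have "\<dots> \<le> norm ((2 * k / \<delta>) * ((u x)\<^sup>2 + (u x)\<^sup>2 / (norm x)\<^sup>2))"
          unfolding real_norm_def by (rule abs_ge_self)
        finally show ?thesis .
      qed (simp add: p0)
    qed
  qed
  have W: "integrable lborel (\<lambda>x. gd x \<bullet> gp x)" "- (LINT x|lborel. \<phi> x * p x) \<le> (LINT x|lborel. gd x \<bullet> gp x)"
  proof -
    have sc: "d (x + h) + d (x - h) - 2 * d x \<le> 1 / \<delta> * (norm h)\<^sup>2" if "x \<in> K" for x h
    proof -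
      have dx: "\<delta> \<le> d x" by (rule \<delta>(2)[OF that])
      then have "d x > 0" using \<delta>(1) by linarith
      then have "d (x + h) + d (x - h) - 2 * d x \<le> (norm h)\<^sup>2 / d x"
        unfolding d_def bdist_def using O(2) by (intro infdist_second_difference) auto
      also have "\<dots> \<le> (norm h)\<^sup>2 / \<delta>" using dx \<delta>(1) by (intro frac_le) auto
      finally show ?thesis by simp
    qed
    have gpm: "gp \<in> borel_measurable lborel" unfolding gp_def[abs_def] using um gm dm gdm by simp
    have lap: "AE x in lborel. x \<in> K \<longrightarrow> (\<exists>l \<le> \<phi> x. (\<lambda>n. \<Sum>b\<in>Basis. dquot2 d b n x) \<longlonglongrightarrow> l)"
      using ae by eventually_elim blast
    have pnn: "0 \<le> p x" for x unfolding p_def using dnn[of x] by simp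
    note * = weak_laplacian_le[OF dl pl compact_imp_bounded[OF du(1)] p0 pnn sc gdm gpm aeG aep gp0 lap iphi]
    show "integrable lborel (\<lambda>x. gd x \<bullet> gp x)" "- (LINT x|lborel. \<phi> x * p x) \<le> (LINT x|lborel. gd x \<bullet> gp x)"
      by (rule *; assumption)+
  qed
  have iB: "integrable lborel (\<lambda>x. (u x)\<^sup>2 / (d x)\<^sup>2)"
    unfolding d_def by (rule integrable_div_bdist_squared[OF u K O])
  have "0 \<le> (LINT x|lborel. (norm (twisted_grad u g x))\<^sup>2 - (1/2) * (gd x \<bullet> gp x) - (1/2) * (\<phi> x * p x) - (1/4) * ((u x)\<^sup>2 / (d x)\<^sup>2))"
  proof (rule integral_nonneg_AE)
    show "AE x in lborel. 0 \<le> (norm (twisted_grad u g x))\<^sup>2 - (1/2) * (gd x \<bullet> gp x) - (1/2) * (\<phi> x * p x) - (1/4) * ((u x)\<^sup>2 / (d x)\<^sup>2)"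
      using aeG AE_lborel_nonzero
    proof eventually_elim
      case (elim x)
      show ?case
      proof (cases "x \<in> K")
        case True
        then have dx: "d x > 0" using \<delta>(1) \<delta>(2)[OF True] by linarith
        have n1: "1 \<le> norm (gd x)"
          using elim(1) True dx O(2) unfolding d_def bdist_def[abs_def]
          by (intro norm_GDERIV_infdist_ge[of "frontier \<Omega>"]) auto
        define r where "r = u x / d x"
        have "0 \<le> (norm (twisted_grad u g x - (r / 2) *\<^sub>R gd x))\<^sup>2" by simp
        also have "\<dots> = (norm (twisted_grad u g x))\<^sup>2 - r * (gd x \<bullet> twisted_grad u g x) + r\<^sup>2 / 4 * (norm (gd x))\<^sup>2"
          unfolding power2_norm_eq_inner by (simp add: inner_simps inner_commute power2_eq_square algebra_simps)
        also have "gd x \<bullet> twisted_grad u g x = gd x \<bullet> g x + k * u x * (x \<bullet> gd x) / (norm x)\<^sup>2"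
          unfolding twisted_grad_def k_def by (simp add: inner_simps inner_commute)
        finally have 1: "0 \<le> (norm (twisted_grad u g x))\<^sup>2 - r * (gd x \<bullet> g x) - r * (k * u x * (x \<bullet> gd x) / (norm x)\<^sup>2)
            + r\<^sup>2 / 4 * (norm (gd x))\<^sup>2" by (simp add: algebra_simps)
        have 2: "gd x \<bullet> gp x = 2 * (r * (gd x \<bullet> g x)) - r\<^sup>2 * (norm (gd x))\<^sup>2"
          unfolding gp_def r_def power2_norm_eq_inner by (simp add: inner_simps power_divide)
        have 3: "\<phi> x * p x = 2 * (r * (k * u x * (x \<bullet> gd x) / (norm x)\<^sup>2))"
          unfolding \<phi>_def p_def r_def by (simp add: power2_eq_square mult_ac)
        have 4: "r\<^sup>2 * 1 \<le> r\<^sup>2 * (norm (gd x))\<^sup>2"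
          using n1 by (intro mult_left_mono) auto
        have 5: "(u x)\<^sup>2 / (d x)\<^sup>2 = r\<^sup>2" by (simp add: r_def power_divide)
        \<comment> \<open>Here \<open>s\<close> is \<open>u^2 / d^2\<close> and \<open>t\<close> is
          \<open>|\<nabla>d|^2\<close>. The two sides differ by \<open>s (t - 1) / 4\<close>, so the
          lower bound \<open>|\<nabla>d| \<ge> 1\<close> is the half of the eikonal equation that
          counts.\<close>
        have "0 \<le> a - b - c + s / 4 * t \<Longrightarrow> s * 1 \<le> s * t \<Longrightarrow>
            0 \<le> a - (1/2) * (2 * b - s * t) - (1/2) * (2 * c) - (1/4) * s" for a b c s t :: real
          by (simp add: field_simps)
        then show ?thesis unfolding 2 3 5 using 1 4 .
      qed (simp add: p0 gp0 du(5))
    qed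
  qed
  also have "\<dots> = hardy_deficit u g - (1/2) * (LINT x|lborel. gd x \<bullet> gp x) - (1/2) * (LINT x|lborel. \<phi> x * p x) - (1/4) * (LINT x|lborel. (u x)\<^sup>2 / (d x)\<^sup>2)"
    unfolding hd(2)
    by (simp only: Bochner_Integration.integral_diff Bochner_Integration.integrable_diff hd(1) W(1) iphi iB
        integrable_mult_right integral_mult_right_zero)
  finally show ?thesis using W(2) unfolding d_def by linarith
qed

lemma set_integral_eq_integral_supported:
  fixes f :: "'a::euclidean_space \<Rightarrow> real"
  assumes "\<And>x. x \<notin> \<Omega> \<Longrightarrow> f x = 0"
  shows "(LINT x:\<Omega>|lborel. f x) = integral\<^sup>L lborel f"
  unfolding set_lebesgue_integral_def
  by (rule Bochner_Integration.integral_cong) (use assms in \<open>auto simp: indicator_def\<close>)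

theorem theorem3p2:
  fixes \<Omega> :: "'a::euclidean_space set"
  assumes "DIM('a) \<ge> 3"
    and "smooth_bounded_domain \<Omega>"
    and "0 \<in> \<Omega>"
  shows "(\<exists>C::real. 0 < C \<and> C \<le> 1/4 \<and>
            (\<forall>u \<in> test_functions \<Omega>.
               (LINT x:\<Omega>|lborel.
                  (norm (grad u x))\<^sup>2 - (real DIM('a) - 2)\<^sup>2 / (4 * (norm x)\<^sup>2) * (u x)\<^sup>2)
               \<ge> C * (LINT x:\<Omega>|lborel. (u x)\<^sup>2 / (bdist \<Omega> x)\<^sup>2)))
       \<and> (div_condition \<Omega> \<longrightarrow>
            (\<forall>u \<in> test_functions \<Omega>.
               (LINT x:\<Omega>|lborel.
                  (norm (grad u x))\<^sup>2 - (real DIM('a) - 2)\<^sup>2 / (4 * (norm x)\<^sup>2) * (u x)\<^sup>2)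
               \<ge> 1/4 * (LINT x:\<Omega>|lborel. (u x)\<^sup>2 / (bdist \<Omega> x)\<^sup>2)))"
proof -
  have O: "open \<Omega>" "bounded \<Omega>" using assms(2) by (auto simp: smooth_bounded_domain_def)
  have fne: "frontier \<Omega> \<noteq> {}"
    using O(2) assms(3) not_bounded_UNIV by (auto simp: frontier_eq_empty)
  have eq1: "(LINT x:\<Omega>|lborel. (norm (grad u x))\<^sup>2 - (real DIM('a) - 2)\<^sup>2 / (4 * (norm x)\<^sup>2) * (u x)\<^sup>2)
       = hardy_deficit u (grad u)"
    and eq2: "(LINT x:\<Omega>|lborel. (u x)\<^sup>2 / (bdist \<Omega> x)\<^sup>2) = (LINT x|lborel. (u x)\<^sup>2 / (bdist \<Omega> x)\<^sup>2)"
    if "C1_supported K u (grad u)" "K \<subseteq> \<Omega>" for K u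
  proof -
    have z: "u x = 0" "grad u x = 0" if "x \<notin> \<Omega>" for x
      using C1_supportedD(5,7)[OF \<open>C1_supported K u (grad u)\<close>, of x] \<open>K \<subseteq> \<Omega>\<close> that by blast+
    show "(LINT x:\<Omega>|lborel. (norm (grad u x))\<^sup>2 - (real DIM('a) - 2)\<^sup>2 / (4 * (norm x)\<^sup>2) * (u x)\<^sup>2)
       = hardy_deficit u (grad u)"
      unfolding hardy_deficit_def by (rule set_integral_eq_integral_supported) (simp add: z)
    show "(LINT x:\<Omega>|lborel. (u x)\<^sup>2 / (bdist \<Omega> x)\<^sup>2) = (LINT x|lborel. (u x)\<^sup>2 / (bdist \<Omega> x)\<^sup>2)"
      by (rule set_integral_eq_integral_supported) (simp add: z)
  qed
  obtain A where A: "A \<ge> 0" "\<And>K u g. C1_supported K u g \<Longrightarrow> K \<subseteq> \<Omega> \<Longrightarrow>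
       (LINT x|lborel. (u x)\<^sup>2 / (bdist \<Omega> x)\<^sup>2) \<le> A * hardy_deficit u g"
    using boundary_hardy[OF assms] by blast
  show ?thesis
  \<comment> \<open>Adding 4 makes the denominator positive even if \<open>A = 0\<close> and yields
    \<open>C \<le> 1/4\<close>; enlarging \<open>A\<close> is harmless because the deficit is
    nonnegative.\<close>
  proof (intro conjI impI ballI exI[of _ "1 / (A + 4)"])
    show "0 < 1 / (A + 4)" "1 / (A + 4) \<le> 1 / 4" using A(1) by (auto simp: field_simps)
  next
    fix u assume "u \<in> test_functions \<Omega>"
    then obtain K where u: "C1_supported K u (grad u)" "K \<subseteq> \<Omega>" by (rule test_functions_C1_supported)
    have "0 \<le> hardy_deficit u (grad u)"
      unfolding hardy_deficit_eq(2)[OF u(1) assms(1)] by simp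
    then have "(LINT x|lborel. (u x)\<^sup>2 / (bdist \<Omega> x)\<^sup>2) \<le> (A + 4) * hardy_deficit u (grad u)"
      using A(2)[OF u] by (simp add: distrib_right)
    then show "(LINT x:\<Omega>|lborel. (norm (grad u x))\<^sup>2 - (real DIM('a) - 2)\<^sup>2 / (4 * (norm x)\<^sup>2) * (u x)\<^sup>2)
               \<ge> 1 / (A + 4) * (LINT x:\<Omega>|lborel. (u x)\<^sup>2 / (bdist \<Omega> x)\<^sup>2)"
      unfolding eq1[OF u] eq2[OF u] using A(1) by (simp add: field_simps)
  next
    fix u assume dc: "div_condition \<Omega>" and "u \<in> test_functions \<Omega>"
    from this(2) obtain K where u: "C1_supported K u (grad u)" "K \<subseteq> \<Omega>"
      by (rule test_functions_C1_supported)
    show "(LINT x:\<Omega>|lborel. (norm (grad u x))\<^sup>2 - (real DIM('a) - 2)\<^sup>2 / (4 * (norm x)\<^sup>2) * (u x)\<^sup>2)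
               \<ge> 1/4 * (LINT x:\<Omega>|lborel. (u x)\<^sup>2 / (bdist \<Omega> x)\<^sup>2)"
      unfolding eq1[OF u] eq2[OF u] by (rule boundary_hardy_sharp[OF assms(1) O(1) fne dc u])
  qed
qed

end
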